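(* Let $n,m\ge 1$ be integers, let $x^1,\ldots,x^m\in\mathbb{R}^n$ and $\omega_1,\ldots,\omega_m>0$. Suppose that the linear system $$(x^i)^Tx\le 0,\quad i=1,\ldots,m,$$ has a nonzero solution $x\in\mathbb{R}^n$. Then $v({\rm P_{ball}})=v({\rm CR_{ball}})$, and $({\rm P_{ball}})$ can be solved in polynomial time. Moreover, the linear system $(x^i)^Tx\le 0$, $i=1,\ldots,m$, has a nonzero solution $x\in\mathbb{R}^n$ whenever $m\le n$.
   Context: $\|\cdot\|$ is the Euclidean norm. The ball-constrained weighted maximin dispersion problem is $$({\rm P_{ball}})\quad \max_{x\in\mathbb{R}^n,\ \|x\|\le 1}\ \min_{i=1,\ldots,m}\omega_i\|x-x^i\|^2,$$ with optimal value $v({\rm P_{ball}})$. Its convex relaxation is $$({\rm CR_{ball}})\quad \max_{x\in\mathbb{R}^n,\ \zeta\in\mathbb{R}}\ \zeta\quad\text{s.t.}\quad \omega_i\left(1-2(x^i)^Tx+\|x^i\|^2\right)\ge\zeta,\ i=1,\ldots,m,\quad \|x\|\le 1,$$ with optimal value $v({\rm CR_{ball}})$. "Polynomial time" is understood in the usual convention of convex optimization, under which linear programs and second-order cone programs are regarded as solvable (to optimality) in polynomial time. *)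

theory Defs
  imports
    "Jordan_Normal_Form.Matrix"
    "HOL-Computational_Algebra.Polynomial"
    "HOL-Library.Extended_Real"
begin

section \<open>The dispersion problem and its convex relaxation\<close>

text \<open>
  One program has to serve all dimensions, so \<open>\<real>\<^sup>n\<close> is \<open>carrier_vec n\<close> and not a type of fixed
  dimension. The points \<open>x\<^sup>1, \<dots>, x\<^sup>m\<close> are \<open>X 0, \<dots>, X (m - 1)\<close>, and likewise for the weights.
\<close>

definition euclid_norm :: "real vec \<Rightarrow> real" where
  "euclid_norm x = sqrt (x \<bullet> x)"

definition dispersion_instance :: "nat \<Rightarrow> nat \<Rightarrow> (nat \<Rightarrow> real vec) \<Rightarrow> (nat \<Rightarrow> real) \<Rightarrow> bool" where
  "dispersion_instance n m X \<omega> \<longleftrightarrow>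
     1 \<le> n \<and> 1 \<le> m \<and> (\<forall>i<m. X i \<in> carrier_vec n) \<and> (\<forall>i<m. 0 < \<omega> i)"

definition has_nonzero_solution :: "nat \<Rightarrow> nat \<Rightarrow> (nat \<Rightarrow> real vec) \<Rightarrow> bool" where
  "has_nonzero_solution n m X \<longleftrightarrow>
     (\<exists>x \<in> carrier_vec n. x \<noteq> 0\<^sub>v n \<and> (\<forall>i<m. X i \<bullet> x \<le> 0))"

definition P_ball_feasible :: "nat \<Rightarrow> real vec set" where
  "P_ball_feasible n = {x \<in> carrier_vec n. euclid_norm x \<le> 1}"

definition P_ball_objective ::
    "nat \<Rightarrow> (nat \<Rightarrow> real vec) \<Rightarrow> (nat \<Rightarrow> real) \<Rightarrow> real vec \<Rightarrow> real" where
  "P_ball_objective m X \<omega> x = (MIN i\<in>{..<m}. \<omega> i * (euclid_norm (x - X i))\<^sup>2)"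

definition CR_ball_feasible ::
    "nat \<Rightarrow> nat \<Rightarrow> (nat \<Rightarrow> real vec) \<Rightarrow> (nat \<Rightarrow> real) \<Rightarrow> (real vec \<times> real) set" where
  "CR_ball_feasible n m X \<omega> =
     {(x, \<zeta>). x \<in> carrier_vec n \<and>
       (\<forall>i<m. \<omega> i * (1 - 2 * (X i \<bullet> x) + (euclid_norm (X i))\<^sup>2) \<ge> \<zeta>) \<and>
       euclid_norm x \<le> 1}"

text \<open>
  Optimal values are suprema in the extended reals, so that no boundedness is presupposed.
\<close>

definition v_P_ball :: "nat \<Rightarrow> nat \<Rightarrow> (nat \<Rightarrow> real vec) \<Rightarrow> (nat \<Rightarrow> real) \<Rightarrow> ereal" where
  "v_P_ball n m X \<omega> = (SUP x \<in> P_ball_feasible n. ereal (P_ball_objective m X \<omega> x))"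

definition v_CR_ball :: "nat \<Rightarrow> nat \<Rightarrow> (nat \<Rightarrow> real vec) \<Rightarrow> (nat \<Rightarrow> real) \<Rightarrow> ereal" where
  "v_CR_ball n m X \<omega> = (SUP (x, \<zeta>) \<in> CR_ball_feasible n m X \<omega>. ereal \<zeta>)"

definition P_ball_optimal ::
    "nat \<Rightarrow> nat \<Rightarrow> (nat \<Rightarrow> real vec) \<Rightarrow> (nat \<Rightarrow> real) \<Rightarrow> real vec \<Rightarrow> bool" where
  "P_ball_optimal n m X \<omega> x \<longleftrightarrow>
     is_arg_max (P_ball_objective m X \<omega>) (\<lambda>y. y \<in> P_ball_feasible n) x"


section \<open>Second-order cone programs\<close>

text \<open>
  \<open>(f, Cs)\<close> is the program: minimise \<open>f \<bullet> x\<close> subject to \<open>\<parallel>A x + b\<parallel> \<le> c \<bullet> x + d\<close> for every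
  \<open>(A, b, c, d)\<close> in \<open>Cs\<close>. Linear programs are the case in which every \<open>A\<close> and \<open>b\<close> is zero.
\<close>

type_synonym cone = "real mat \<times> real vec \<times> real vec \<times> real"
type_synonym socp = "real vec \<times> cone list"

fun socp_feasible :: "socp \<Rightarrow> real vec \<Rightarrow> bool" where
  "socp_feasible (f, Cs) x \<longleftrightarrow>
     x \<in> carrier_vec (dim_vec f) \<and>
     (\<forall>(A, b, c, d) \<in> set Cs. euclid_norm (A *\<^sub>v x + b) \<le> c \<bullet> x + d)"

definition socp_optimal :: "socp \<Rightarrow> real vec \<Rightarrow> bool" where
  "socp_optimal I x \<longleftrightarrow> is_arg_min (\<lambda>y. fst I \<bullet> y) (socp_feasible I) x"

fun socp_size :: "socp \<Rightarrow> nat" where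
  "socp_size (f, Cs) =
     dim_vec f + (\<Sum>(A, b, c, d)\<leftarrow>Cs. dim_row A * dim_col A + dim_vec b + dim_vec c + 1)"

text \<open>
  The convention that linear and second-order cone programs are solvable to optimality in
  polynomial time: \<open>slv\<close> returns an optimal solution whenever one exists (its answer is arbitrary
  otherwise) and \<open>cst\<close>, its running time, is polynomially bounded.
\<close>

definition poly_time_socp_solver :: "(socp \<Rightarrow> real vec) \<Rightarrow> (socp \<Rightarrow> nat) \<Rightarrow> bool" where
  "poly_time_socp_solver slv cst \<longleftrightarrow>
     (\<forall>I. (\<exists>x. socp_optimal I x) \<longrightarrow> socp_optimal I (slv I)) \<and>
     (\<exists>q :: nat poly. \<forall>I. cst I \<le> poly q (socp_size I))"


section \<open>Real-number programs with a cone-program subroutine\<close>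

text \<open>
  A real random access machine: named index registers hold natural numbers, with addition and
  truncated subtraction only; real cells are entries of named multi-dimensional arrays, with exact
  field arithmetic and comparisons. Literals are integers, so a program carries no real advice.
\<close>

type_synonym regs = "string \<Rightarrow> nat"
type_synonym mem = "string \<Rightarrow> nat list \<Rightarrow> real"
type_synonym state = "regs \<times> mem"

datatype iexp = INum nat | IReg string | IAdd iexp iexp | ISub iexp iexp

datatype rexp = RNum int | RCell string "iexp list"
  | RAdd rexp rexp | RSub rexp rexp | RMul rexp rexp | RDiv rexp rexp

datatype bexp = ILess iexp iexp | RLess rexp rexp | BNot bexp | BAnd bexp bexp

datatype com = Skip
  | SetReg string iexp
  | SetCell string "iexp list" rexp
  | Seq com com
  | If bexp com com
  | While bexp com
  | SolveSOCP iexp iexp iexp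

primrec ival :: "iexp \<Rightarrow> regs \<Rightarrow> nat" where
  "ival (INum k) r = k"
| "ival (IReg v) r = r v"
| "ival (IAdd e e') r = ival e r + ival e' r"
| "ival (ISub e e') r = ival e r - ival e' r"

primrec rval :: "rexp \<Rightarrow> state \<Rightarrow> real" where
  "rval (RNum k) s = of_int k"
| "rval (RCell a es) s = snd s a (map (\<lambda>e. ival e (fst s)) es)"
| "rval (RAdd e e') s = rval e s + rval e' s"
| "rval (RSub e e') s = rval e s - rval e' s"
| "rval (RMul e e') s = rval e s * rval e' s"
| "rval (RDiv e e') s = rval e s / rval e' s"

primrec bval :: "bexp \<Rightarrow> state \<Rightarrow> bool" where
  "bval (ILess e e') s \<longleftrightarrow> ival e (fst s) < ival e' (fst s)"
| "bval (RLess e e') s \<longleftrightarrow> rval e s < rval e' s"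
| "bval (BNot b) s \<longleftrightarrow> \<not> bval b s"
| "bval (BAnd b b') s \<longleftrightarrow> bval b s \<and> bval b' s"

fun set_cell :: "string \<Rightarrow> nat list \<Rightarrow> real \<Rightarrow> state \<Rightarrow> state" where
  "set_cell a ks z (r, M) = (r, M(a := (M a)(ks := z)))"

text \<open>
  A query with \<open>N\<close> variables and \<open>K\<close> cones, each with \<open>R\<close> rows, is read from the arrays \<open>obj\<close>,
  \<open>A\<close>, \<open>b\<close>, \<open>c\<close>, \<open>d\<close>. Cones with fewer rows are padded with zero rows.
\<close>

definition socp_query :: "mem \<Rightarrow> nat \<Rightarrow> nat \<Rightarrow> nat \<Rightarrow> socp" where
  "socp_query M N K R =
     (vec N (\<lambda>j. M ''obj'' [j]),
      map (\<lambda>k. (mat R N (\<lambda>(i, j). M ''A'' [k, i, j]),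
                vec R (\<lambda>i. M ''b'' [k, i]),
                vec N (\<lambda>j. M ''c'' [k, j]),
                M ''d'' [k])) [0..<K])"

definition store_solution :: "nat \<Rightarrow> real vec \<Rightarrow> mem \<Rightarrow> mem" where
  "store_solution N y M =
     M(''sol'' := (\<lambda>ks. case ks of
                     [j] \<Rightarrow> if j < N then y $ j else M ''sol'' ks
                   | _ \<Rightarrow> M ''sol'' ks))"

text \<open>
  \<open>exec slv cst p s t s'\<close>: program \<open>p\<close> started in \<open>s\<close> terminates in \<open>s'\<close> after time \<open>t\<close>.
  Every assignment and every test costs one unit (the expressions in a program have fixed size).
  A subroutine call costs the solver's time plus the size of the query, so large queries are never
  free even though unwritten cells are zero.
\<close>

inductive exec ::
    "(socp \<Rightarrow> real vec) \<Rightarrow> (socp \<Rightarrow> nat) \<Rightarrow> com \<Rightarrow> state \<Rightarrow> nat \<Rightarrow> state \<Rightarrow> bool"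
  for slv :: "socp \<Rightarrow> real vec" and cst :: "socp \<Rightarrow> nat" where
  Skip: "exec slv cst Skip s 1 s"
| SetReg: "exec slv cst (SetReg v e) (r, M) 1 (r(v := ival e r), M)"
| SetCell: "exec slv cst (SetCell a es e) s 1
              (set_cell a (map (\<lambda>e. ival e (fst s)) es) (rval e s) s)"
| Seq: "\<lbrakk>exec slv cst p s t s'; exec slv cst q s' t' s''\<rbrakk>
        \<Longrightarrow> exec slv cst (Seq p q) s (t + t') s''"
| IfTrue: "\<lbrakk>bval b s; exec slv cst p s t s'\<rbrakk> \<Longrightarrow> exec slv cst (If b p q) s (1 + t) s'"
| IfFalse: "\<lbrakk>\<not> bval b s; exec slv cst q s t s'\<rbrakk> \<Longrightarrow> exec slv cst (If b p q) s (1 + t) s'"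
| WhileFalse: "\<not> bval b s \<Longrightarrow> exec slv cst (While b p) s 1 s"
| WhileTrue: "\<lbrakk>bval b s; exec slv cst p s t s'; exec slv cst (While b p) s' t' s''\<rbrakk>
        \<Longrightarrow> exec slv cst (While b p) s (1 + t + t') s''"
| SolveSOCP: "I = socp_query M (ival eN r) (ival eK r) (ival eR r)
        \<Longrightarrow> exec slv cst (SolveSOCP eN eK eR) (r, M) (1 + socp_size I + cst I)
              (r, store_solution (ival eN r) (slv I) M)"

text \<open>
  A problem on the instances \<open>D\<close> is solved in polynomial time if one program, independent of the
  solver plugged in, maps every encoded instance to an accepted final state within time polynomial
  in the instance size. The polynomial may depend on the solver, through its running time.
\<close>

definition poly_time_solvable ::
    "'i set \<Rightarrow> ('i \<Rightarrow> nat) \<Rightarrow> ('i \<Rightarrow> state) \<Rightarrow> ('i \<Rightarrow> state \<Rightarrow> bool) \<Rightarrow> bool" where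
  "poly_time_solvable D sz enc ok \<longleftrightarrow>
     (\<exists>p. \<forall>slv cst. poly_time_socp_solver slv cst \<longrightarrow>
       (\<exists>q :: nat poly. \<forall>I \<in> D. \<exists>t s.
          exec slv cst p (enc I) t s \<and> t \<le> poly q (sz I) \<and> ok I s))"


section \<open>The dispersion problem as a computational problem\<close>

type_synonym dispersion = "nat \<times> nat \<times> (nat \<Rightarrow> real vec) \<times> (nat \<Rightarrow> real)"

fun encode_dispersion :: "dispersion \<Rightarrow> state" where
  "encode_dispersion (n, m, X, \<omega>) =
     ((\<lambda>v. if v = ''n'' then n else if v = ''m'' then m else 0),
      (\<lambda>a ks. case ks of
         [i, j] \<Rightarrow> if a = ''x'' \<and> i < m \<and> j < n then X i $ j else 0
       | [i] \<Rightarrow> if a = ''w'' \<and> i < m then \<omega> i else 0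
       | _ \<Rightarrow> 0))"

text \<open>The number of reals in the input.\<close>

fun dispersion_size :: "dispersion \<Rightarrow> nat" where
  "dispersion_size (n, m, X, \<omega>) = m * n + m"

fun outputs_P_ball_optimum :: "dispersion \<Rightarrow> state \<Rightarrow> bool" where
  "outputs_P_ball_optimum (n, m, X, \<omega>) s \<longleftrightarrow>
     P_ball_optimal n m X \<omega> (vec n (\<lambda>j. snd s ''out'' [j]))"

definition P_ball_poly_time_on :: "dispersion set \<Rightarrow> bool" where
  "P_ball_poly_time_on D \<longleftrightarrow>
     poly_time_solvable D dispersion_size encode_dispersion outputs_P_ball_optimum"

end

theory Submission
  imports Defs "HOL-Analysis.Function_Topology" "Jordan_Normal_Form.Determinant"
begin

text \<open>
  If \<open>d \<noteq> 0\<close> satisfies \<open>X i \<bullet> d \<le> 0\<close> for all \<open>i\<close>, then moving along \<open>d\<close> preserves the linear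
  constraints of the relaxation, so every feasible point of the relaxation can be pushed to the unit
  sphere, where the relaxation agrees with the dispersion problem.

  For the algorithm, neither \<open>d\<close> nor a square root is needed. After one cone program has found the
  optimal value of the relaxation, maximise \<open>\<plusminus>x\<^sub>j\<close> over its optimal set for every coordinate \<open>j\<close>.
  A maximiser of a linear function that increases along \<open>d\<close> lies on the sphere, since otherwise it
  could be moved further along \<open>d\<close>; this happens for at least one of the \<open>2n\<close> objectives, and
  comparing \<open>\<parallel>x\<parallel>\<^sup>2\<close> with \<open>1\<close> detects it.

  If \<open>m \<le> n\<close>, pad the points with zero rows to a square matrix \<open>A\<close>: either \<open>A\<close> is singular and has
  a kernel vector, or \<open>A x = (-1, \<dots>, -1)\<close> is solvable.
\<close>

section \<open>Exactness of the relaxation\<close>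

lemma scalar_prod_conv_sum:
  "y \<in> carrier_vec n \<Longrightarrow> x \<bullet> y = (\<Sum>i<n. x $ i * y $ i)"
  by (auto simp: scalar_prod_def atLeast0LessThan)

lemma scalar_prod_self_nonneg: "0 \<le> (x :: real vec) \<bullet> x"
  by (auto simp: scalar_prod_def intro: sum_nonneg)

lemma nonzero_vec_entry:
  assumes "x \<in> carrier_vec n" "x \<noteq> 0\<^sub>v n"
  obtains i where "i < n" "x $ i \<noteq> 0"
  using assms by (metis carrier_vecD eq_vecI index_zero_vec)

lemma scalar_prod_self_pos:
  assumes "x \<in> carrier_vec n" "x \<noteq> 0\<^sub>v n"
  shows "0 < (x :: real vec) \<bullet> x"
proof -
  obtain i where "i < n" "x $ i \<noteq> 0"
    using nonzero_vec_entry[OF assms] .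
  then have "0 < (\<Sum>i<n. x $ i * x $ i)"
    by (intro sum_pos2[of _ i]) (auto simp: zero_less_mult_iff)
  then show ?thesis
    using assms by (simp add: scalar_prod_conv_sum)
qed

lemma euclid_norm_power2: "(euclid_norm x)\<^sup>2 = x \<bullet> x"
  by (simp add: euclid_norm_def scalar_prod_self_nonneg)

lemma euclid_norm_le_1_iff: "euclid_norm x \<le> 1 \<longleftrightarrow> x \<bullet> x \<le> 1"
  by (simp add: euclid_norm_def)

lemma euclid_norm_zero: "euclid_norm (0\<^sub>v n) = 0"
  by (simp add: euclid_norm_def)

lemma scalar_prod_diff_self:
  fixes x y :: "real vec"
  assumes "x \<in> carrier_vec n" "y \<in> carrier_vec n"
  shows "(x - y) \<bullet> (x - y) = x \<bullet> x - 2 * (y \<bullet> x) + y \<bullet> y"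
  using assms
  by (simp add: minus_scalar_prod_distrib[of _ n] scalar_prod_minus_distrib[of _ n] comm_scalar_prod[of x n y])

lemma scalar_prod_add_smult_self:
  fixes x d :: "real vec"
  assumes "x \<in> carrier_vec n" "d \<in> carrier_vec n"
  shows "(x + t \<cdot>\<^sub>v d) \<bullet> (x + t \<cdot>\<^sub>v d) = x \<bullet> x + 2 * t * (x \<bullet> d) + t\<^sup>2 * (d \<bullet> d)"
  using assms
  by (simp add: add_scalar_prod_distrib[of _ n] scalar_prod_add_distrib[of _ n] comm_scalar_prod[of d n x]
      power2_eq_square algebra_simps)

text \<open>The squared norm along the ray is a quadratic in \<open>t\<close> with leading
  coefficient \<open>d \<bullet> d > 0\<close> and value at most \<open>1\<close> at
  \<open>t = 0\<close>, so it reaches \<open>1\<close> at some \<open>t \<ge> 0\<close>.\<close>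

lemma ray_meets_sphere:
  assumes x: "x \<in> carrier_vec n" "x \<bullet> x \<le> 1" and d: "d \<in> carrier_vec n" "d \<noteq> 0\<^sub>v n"
  obtains t :: real where "0 \<le> t" "(x + t \<cdot>\<^sub>v d) \<bullet> (x + t \<cdot>\<^sub>v d) = 1"
proof
  define a b c where "a = d \<bullet> d" and "b = x \<bullet> d" and "c = x \<bullet> x"
  \<comment> \<open>\<open>(r - b) / a\<close> is the larger root of
    \<open>a t^2 + 2 b t + c = 1\<close>. As \<open>c \<le> 1\<close>, the radicand is at least
    \<open>b^2\<close>, which makes this root nonnegative.\<close>
  define r where "r = sqrt (b\<^sup>2 + a * (1 - c))"
  have a: "0 < a"
    unfolding a_def using d by (rule scalar_prod_self_pos)
  have ac: "0 \<le> a * (1 - c)"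
    using a x(2) by (simp add: c_def)
  then have "\<bar>b\<bar> \<le> r"
    unfolding r_def by (intro real_le_rsqrt) simp
  then show "0 \<le> (r - b) / a"
    using a by simp
  have "r\<^sup>2 = b\<^sup>2 + a * (1 - c)"
    unfolding r_def using ac by simp
  moreover have "c + 2 * ((r - b) / a) * b + ((r - b) / a)\<^sup>2 * a = c + (r\<^sup>2 - b\<^sup>2) / a"
    using a by (simp add: field_simps power2_eq_square)
  ultimately show "(x + ((r - b) / a) \<cdot>\<^sub>v d) \<bullet> (x + ((r - b) / a) \<cdot>\<^sub>v d) = 1"
    using a x d by (simp add: scalar_prod_add_smult_self a_def[symmetric] b_def[symmetric] c_def[symmetric])
qed

section \<open>Comparison of the two problems on the ball and on the sphere\<close>

lemma P_ball_objective_ge_iff: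
  assumes "dispersion_instance n m X \<omega>"
  shows "\<zeta> \<le> P_ball_objective m X \<omega> x \<longleftrightarrow> (\<forall>i<m. \<zeta> \<le> \<omega> i * (euclid_norm (x - X i))\<^sup>2)"
  using assms by (auto simp: dispersion_instance_def P_ball_objective_def lessThan_empty_iff)

text \<open>The relaxation replaces \<open>x \<bullet> x\<close> by \<open>1\<close> in the expanded
  squared distance. In the ball this can only enlarge the bounds, since the weights are
  positive.\<close>

lemma CR_ball_feasible_of_P_ball_feasible:
  assumes I: "dispersion_instance n m X \<omega>" and x: "x \<in> P_ball_feasible n"
  shows "(x, P_ball_objective m X \<omega> x) \<in> CR_ball_feasible n m X \<omega>"
proof -
  have "P_ball_objective m X \<omega> x \<le> \<omega> i * (1 - 2 * (X i \<bullet> x) + (euclid_norm (X i))\<^sup>2)" if "i < m" for i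
  proof -
    have "P_ball_objective m X \<omega> x \<le> \<omega> i * (euclid_norm (x - X i))\<^sup>2"
      using P_ball_objective_ge_iff[OF I] that by blast
    also have "\<dots> \<le> \<omega> i * (1 - 2 * (X i \<bullet> x) + (euclid_norm (X i))\<^sup>2)"
      using I x that
      by (intro mult_left_mono)
        (auto simp: dispersion_instance_def P_ball_feasible_def euclid_norm_power2 scalar_prod_diff_self[of _ n]
          euclid_norm_le_1_iff less_imp_le)
    finally show ?thesis .
  qed
  with x show ?thesis
    by (auto simp: CR_ball_feasible_def P_ball_feasible_def)
qed

text \<open>On the sphere, replacing \<open>x \<bullet> x\<close> by \<open>1\<close> loses
  nothing.\<close>

lemma P_ball_objective_ge_on_sphere:
  assumes I: "dispersion_instance n m X \<omega>" and x: "(x, \<zeta>) \<in> CR_ball_feasible n m X \<omega>" "x \<bullet> x = 1"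
  shows "x \<in> P_ball_feasible n" "\<zeta> \<le> P_ball_objective m X \<omega> x"
  unfolding P_ball_objective_ge_iff[OF I] using assms
  by (auto simp: dispersion_instance_def P_ball_feasible_def CR_ball_feasible_def euclid_norm_power2
      scalar_prod_diff_self[of _ n])

text \<open>The move changes the \<open>i\<close>-th bound by
  \<open>- 2 * \<omega> i * t * (X i \<bullet> d) \<ge> 0\<close>, so the same
  \<open>\<zeta>\<close> stays admissible.\<close>

lemma CR_ball_feasible_add_smult:
  assumes I: "dispersion_instance n m X \<omega>" and x: "(x, \<zeta>) \<in> CR_ball_feasible n m X \<omega>"
    and d: "d \<in> carrier_vec n" "\<forall>i<m. X i \<bullet> d \<le> 0"
    and t: "0 \<le> t" "(x + t \<cdot>\<^sub>v d) \<bullet> (x + t \<cdot>\<^sub>v d) = 1"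
  shows "(x + t \<cdot>\<^sub>v d, \<zeta>) \<in> CR_ball_feasible n m X \<omega>"
proof -
  have "\<zeta> \<le> \<omega> i * (1 - 2 * (X i \<bullet> (x + t \<cdot>\<^sub>v d)) + (euclid_norm (X i))\<^sup>2)" if "i < m" for i
  proof -
    have "\<zeta> \<le> \<omega> i * (1 - 2 * (X i \<bullet> x) + (euclid_norm (X i))\<^sup>2)"
      using x that by (auto simp: CR_ball_feasible_def)
    also have "\<dots> \<le> \<omega> i * (1 - 2 * (X i \<bullet> (x + t \<cdot>\<^sub>v d)) + (euclid_norm (X i))\<^sup>2)"
      using I x d t(1) that
      by (intro mult_left_mono)
        (auto simp: dispersion_instance_def CR_ball_feasible_def scalar_prod_add_distrib[of _ n] less_imp_le
          mult_le_0_iff)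
    finally show ?thesis .
  qed
  then show ?thesis
    using x d t(2) by (auto simp: CR_ball_feasible_def euclid_norm_le_1_iff)
qed

text \<open>A feasible point of either problem yields one of the other with at least the same value,
  so the suprema agree without any appeal to attainment.\<close>

lemma v_P_ball_eq_v_CR_ball:
  assumes I: "dispersion_instance n m X \<omega>" and sol: "has_nonzero_solution n m X"
  shows "v_P_ball n m X \<omega> = v_CR_ball n m X \<omega>"
proof (rule antisym)
  show "v_P_ball n m X \<omega> \<le> v_CR_ball n m X \<omega>"
    unfolding v_P_ball_def v_CR_ball_def
    by (rule SUP_least)
      (use CR_ball_feasible_of_P_ball_feasible[OF I] in \<open>auto intro!: SUP_upper2\<close>)
  obtain d where d: "d \<in> carrier_vec n" "d \<noteq> 0\<^sub>v n" "\<forall>i<m. X i \<bullet> d \<le> 0"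
    using sol by (auto simp: has_nonzero_solution_def)
  have "ereal \<zeta> \<le> v_P_ball n m X \<omega>" if x: "(x, \<zeta>) \<in> CR_ball_feasible n m X \<omega>" for x \<zeta>
  proof -
    have "x \<in> carrier_vec n" "x \<bullet> x \<le> 1"
      using x by (auto simp: CR_ball_feasible_def euclid_norm_le_1_iff)
    then obtain t where t: "0 \<le> t" "(x + t \<cdot>\<^sub>v d) \<bullet> (x + t \<cdot>\<^sub>v d) = 1"
      using ray_meets_sphere d by metis
    note * = P_ball_objective_ge_on_sphere[OF I CR_ball_feasible_add_smult[OF I x d(1,3) t] t(2)]
    show ?thesis
      unfolding v_P_ball_def using * by (intro SUP_upper2[OF *(1)]) simp
  qed
  then show "v_CR_ball n m X \<omega> \<le> v_P_ball n m X \<omega>"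
    unfolding v_CR_ball_def by (auto intro!: SUP_least)
qed

section \<open>Solvability of the linear system for \<open>m \<le> n\<close>\<close>

lemma has_nonzero_solution_if_le:
  assumes I: "dispersion_instance n m X \<omega>" and "m \<le> n"
  shows "has_nonzero_solution n m X"
proof -
  \<comment> \<open>Zero rows from index \<open>m\<close> on make the matrix square, so that
    determinant and adjugate apply; the constraints concern the first \<open>m\<close> rows
    only.\<close>
  define A where "A = mat_of_rows n (map (\<lambda>i. if i < m then X i else 0\<^sub>v n) [0..<n])"
  have A: "A \<in> carrier_mat n n"
    by (auto simp: A_def)
  have row_A: "(A *\<^sub>v x) $ i = X i \<bullet> x" if "i < m" for i x
    using that assms by (auto simp: A_def dispersion_instance_def)
  show ?thesis
  proof (cases "det A = 0")
    case True
    then obtain x where x: "x \<in> carrier_vec n" "x \<noteq> 0\<^sub>v n" "A *\<^sub>v x = 0\<^sub>v n"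
      using det_0_iff_vec_prod_zero[OF A] by auto
    then have "\<forall>i<m. X i \<bullet> x \<le> 0"
      using row_A[of _ x] \<open>m \<le> n\<close> by auto
    with x show ?thesis
      by (auto simp: has_nonzero_solution_def)
  next
    case False
    \<comment> \<open>The adjugate divided by the determinant acts as the inverse of
      \<open>A\<close>.\<close>
    define x where "x = (1 / det A) \<cdot>\<^sub>v (adj_mat A *\<^sub>v vec n (\<lambda>_. - 1))"
    have x: "x \<in> carrier_vec n"
      using adj_mat(1)[OF A] by (simp add: x_def)
    have "A *\<^sub>v x = (1 / det A) \<cdot>\<^sub>v ((A * adj_mat A) *\<^sub>v vec n (\<lambda>_. - 1))"
      unfolding x_def using A adj_mat(1)[OF A]
      by (simp add: mult_mat_vec[of _ n n] assoc_mult_mat_vec[of _ n n _ n])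
    also have "\<dots> = vec n (\<lambda>_. - 1)"
      unfolding adj_mat(2)[OF A] using False by auto
    finally have Ax: "X i \<bullet> x = - 1" if "i < m" for i
      using row_A[OF that, of x] \<open>m \<le> n\<close> that by simp
    \<comment> \<open>\<open>1 \<le> m\<close> provides row \<open>0\<close>, whose scalar product
      with \<open>x\<close> is \<open>-1\<close>.\<close>
    have "x \<noteq> 0\<^sub>v n"
      using Ax[of 0] I by (auto simp: dispersion_instance_def)
    with x Ax show ?thesis
      by (auto simp: has_nonzero_solution_def)
  qed
qed

section \<open>Existence of optima by compactness\<close>

text \<open>
  A vector of dimension \<open>n + 1\<close> encodes a pair \<open>(x, \<zeta>)\<close>; the constraint \<open>\<delta> \<le> \<zeta>\<close> makes the
  feasible set compact.
\<close>

definition lifted_feasible ::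
    "nat \<Rightarrow> nat \<Rightarrow> (nat \<Rightarrow> real vec) \<Rightarrow> (nat \<Rightarrow> real) \<Rightarrow> real \<Rightarrow> real vec \<Rightarrow> bool" where
  "lifted_feasible n m X \<omega> \<delta> y \<longleftrightarrow>
     y \<in> carrier_vec (Suc n) \<and> (vec n (\<lambda>j. y $ j), y $ n) \<in> CR_ball_feasible n m X \<omega> \<and> \<delta> \<le> y $ n"

text \<open>In coordinates the set is cut out by finitely many polynomial inequalities. This form
  serves the compactness argument and the comparison with the cones in memory.\<close>

lemma lifted_feasible_iff:
  assumes I: "dispersion_instance n m X \<omega>"
  shows "lifted_feasible n m X \<omega> \<delta> y \<longleftrightarrow> y \<in> carrier_vec (Suc n) \<and>
    (\<forall>i<m. y $ n \<le> \<omega> i * (1 - 2 * (\<Sum>j<n. X i $ j * y $ j) + (\<Sum>j<n. (X i $ j)\<^sup>2))) \<and>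
    (\<Sum>j<n. (y $ j)\<^sup>2) \<le> 1 \<and> \<delta> \<le> y $ n"
proof -
  have *: "(euclid_norm (X i))\<^sup>2 = (\<Sum>j<n. (X i $ j)\<^sup>2)" if "i < m" for i
    using that I
    by (simp add: dispersion_instance_def euclid_norm_power2 scalar_prod_conv_sum[of _ n] power2_eq_square[of "_ $ _"])
  show ?thesis
    unfolding lifted_feasible_def CR_ball_feasible_def euclid_norm_le_1_iff
    by (auto simp: * scalar_prod_conv_sum[of _ n] power2_eq_square[of "_ $ _"])
qed

text \<open>Tychonoff's theorem, since function types carry the product topology. Compactness for
  vectors is argued on their coordinate functions.\<close>

lemma compact_PiE_UNIV:
  assumes "\<And>i. compact (B i :: 'b :: topological_space set)"
  shows "compact (PiE UNIV B :: ('a \<Rightarrow> 'b) set)"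
  using compactin_PiE[of "\<lambda>_. euclidean" UNIV B] assms by (simp add: euclidean_product_topology)

text \<open>A solver promises an optimum only where one exists, so attainment has to be known before
  each call. It is Weierstrass' theorem: the linear objective is continuous on a compact set
  \<open>K\<close> of coordinate functions that correspond to the feasible vectors.\<close>

lemma lifted_optimum_exists:
  fixes f :: "real vec"
  assumes I: "dispersion_instance n m X \<omega>" and y0: "lifted_feasible n m X \<omega> \<delta> y0"
  shows "\<exists>y. is_arg_min (\<lambda>y. f \<bullet> y) (lifted_feasible n m X \<omega> \<delta>) y"
proof -
  \<comment> \<open>Upper bound on \<open>\<zeta>\<close> from constraint \<open>0\<close>, using
    that the coordinates of \<open>x\<close> lie between \<open>-1\<close> and
    \<open>1\<close>.\<close>
  define u where "u = \<omega> 0 * (1 + 2 * (\<Sum>j<n. \<bar>X 0 $ j\<bar>) + (\<Sum>j<n. (X 0 $ j)\<^sup>2))"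
  \<comment> \<open>Coordinates beyond \<open>n\<close> are pinned to \<open>0\<close>, matching the
    padding in \<open>emb\<close>, so that every factor of the product is compact.\<close>
  define B where "B j = (if j < n then {-1..1} else if j = n then {\<delta>..u} else {0})" for j :: nat
  define F where "F = {g. (\<forall>i<m. g n \<le> \<omega> i * (1 - 2 * (\<Sum>j<n. X i $ j * g j) + (\<Sum>j<n. (X i $ j)\<^sup>2))) \<and>
     (\<Sum>j<n. (g j)\<^sup>2) \<le> (1::real)}"
  define K where "K = PiE UNIV B \<inter> F"
  define emb where "emb y = (\<lambda>j. if j < Suc n then y $ j else 0)" for y :: "real vec"
  have "closed F"
    unfolding F_def
    by (intro closed_Collect_conj closed_Collect_all closed_Collect_imp open_Collect_const closed_Collect_le
        continuous_on_const continuous_on_mult continuous_on_add continuous_on_diff continuous_on_sum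
        continuous_on_power continuous_on_product_coordinates)
  then have "compact K"
    unfolding K_def by (intro compact_Int_closed compact_PiE_UNIV) (auto simp: B_def)
  have emb_K: "emb y \<in> K" if y: "lifted_feasible n m X \<omega> \<delta> y" for y
  proof -
    note y' = y[unfolded lifted_feasible_iff[OF I]]
    have abs1: "\<bar>y $ j\<bar> \<le> 1" if "j < n" for j
    proof -
      have "(y $ j)\<^sup>2 \<le> (\<Sum>j<n. (y $ j)\<^sup>2)"
        using that by (intro member_le_sum) auto
      with y' have "(y $ j)\<^sup>2 \<le> 1" by linarith
      then show ?thesis by (simp add: abs_square_le_1)
    qed
    have "- (\<Sum>j<n. X 0 $ j * y $ j) \<le> (\<Sum>j<n. \<bar>X 0 $ j\<bar>)"
      unfolding sum_negf[symmetric]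
    proof (rule sum_mono)
      fix j assume "j \<in> {..<n}"
      then have "\<bar>X 0 $ j\<bar> * \<bar>y $ j\<bar> \<le> \<bar>X 0 $ j\<bar> * 1"
        using abs1 by (intro mult_left_mono) auto
      then show "- (X 0 $ j * y $ j) \<le> \<bar>X 0 $ j\<bar>"
        by (simp add: abs_mult[symmetric])
    qed
    moreover have m: "0 < m" "0 < \<omega> 0"
      using I by (auto simp: dispersion_instance_def)
    ultimately have "\<omega> 0 * (1 - 2 * (\<Sum>j<n. X 0 $ j * y $ j) + (\<Sum>j<n. (X 0 $ j)\<^sup>2)) \<le> u"
      unfolding u_def by (intro mult_left_mono) linarith+
    then have "y $ n \<le> u"
      using y' m(1) by (meson order_trans)
    then have "emb y \<in> PiE UNIV B"
      using abs1 y' by (auto simp: PiE_iff B_def emb_def abs_le_iff)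
    moreover have "emb y \<in> F"
      using y' by (auto simp: F_def emb_def)
    ultimately show ?thesis
      by (simp add: K_def)
  qed
  have "K \<noteq> {}"
    using emb_K[OF y0] by auto
  moreover have "continuous_on K (\<lambda>g. \<Sum>j<Suc n. f $ j * g j)"
    by (intro continuous_on_sum continuous_on_mult continuous_on_const
        continuous_on_subset[OF continuous_on_product_coordinates subset_UNIV])
  ultimately obtain g where g: "g \<in> K" "\<And>h. h \<in> K \<Longrightarrow> (\<Sum>j<Suc n. f $ j * g j) \<le> (\<Sum>j<Suc n. f $ j * h j)"
    using continuous_attains_inf[OF \<open>compact K\<close>] by blast
  \<comment> \<open>The constraint \<open>\<delta> \<le> \<zeta>\<close> is not part of
    \<open>F\<close>; it comes from the box.\<close>
  have "g n \<in> B n"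
    using g(1) by (auto simp: K_def PiE_iff)
  then have "lifted_feasible n m X \<omega> \<delta> (vec (Suc n) g)"
    using g(1) by (auto simp: lifted_feasible_iff[OF I] K_def F_def B_def)
  moreover have "f \<bullet> vec (Suc n) g \<le> f \<bullet> y" if y: "lifted_feasible n m X \<omega> \<delta> y" for y
  proof -
    have "f \<bullet> vec (Suc n) g = (\<Sum>j<Suc n. f $ j * g j)"
      by (simp add: scalar_prod_conv_sum[of _ "Suc n"])
    also have "\<dots> \<le> (\<Sum>j<Suc n. f $ j * emb y j)"
      by (rule g(2)[OF emb_K[OF y]])
    also have "\<dots> = f \<bullet> y"
      using y by (simp add: lifted_feasible_def scalar_prod_conv_sum[of _ "Suc n"] emb_def)
    finally show ?thesis .
  qed
  ultimately show ?thesis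
    by (auto simp: is_arg_min_def not_less)
qed

section \<open>The relaxation as a cone program\<close>

text \<open>\<open>\<delta>\<close> bounds the relaxation, hence the objective on the whole ball. On
  the sphere the relaxed value of \<open>y\<close>, which is at least \<open>\<delta>\<close>, is a
  lower bound for the objective.\<close>

lemma P_ball_optimal_if_on_sphere:
  assumes I: "dispersion_instance n m X \<omega>"
    and ub: "\<forall>(x, \<zeta>) \<in> CR_ball_feasible n m X \<omega>. \<zeta> \<le> \<delta>"
    and y: "lifted_feasible n m X \<omega> \<delta> y" "1 \<le> (\<Sum>j<n. (y $ j)\<^sup>2)"
  shows "P_ball_optimal n m X \<omega> (vec n (\<lambda>j. y $ j))"
proof -
  let ?x = "vec n (\<lambda>j. y $ j)"
  have feas: "(?x, y $ n) \<in> CR_ball_feasible n m X \<omega>" "\<delta> \<le> y $ n"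
    using y(1) by (auto simp: lifted_feasible_def)
  \<comment> \<open>Feasibility gives \<open>\<le> 1\<close> and the assumption
    \<open>\<ge> 1\<close>; hence a program need only test whether the sum is less than
    \<open>1\<close>.\<close>
  have "?x \<bullet> ?x = 1"
    using y I by (auto simp: lifted_feasible_iff scalar_prod_conv_sum[of _ n] power2_eq_square)
  note * = P_ball_objective_ge_on_sphere[OF I feas(1) this]
  have "P_ball_objective m X \<omega> z \<le> P_ball_objective m X \<omega> ?x" if "z \<in> P_ball_feasible n" for z
    using ub CR_ball_feasible_of_P_ball_feasible[OF I that] *(2) feas(2) by fastforce
  with *(1) show ?thesis
    by (auto simp: P_ball_optimal_def is_arg_max_def not_less)
qed

text \<open>From inside the ball one can move by some \<open>t > 0\<close> along \<open>d\<close> up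
  to the sphere. This keeps feasibility and changes the objective \<open>s * y $ j\<close> by
  \<open>t * (s * d $ j) < 0\<close>, against minimality.\<close>

lemma minimiser_on_sphere:
  assumes I: "dispersion_instance n m X \<omega>"
    and d: "d \<in> carrier_vec n" "d \<noteq> 0\<^sub>v n" "\<forall>i<m. X i \<bullet> d \<le> 0"
    and j: "j < n" "s * d $ j < 0"
    and y: "is_arg_min (\<lambda>y. vec (Suc n) (\<lambda>l. if l = j then s else 0) \<bullet> y) (lifted_feasible n m X \<omega> \<delta>) y"
  shows "1 \<le> (\<Sum>j<n. (y $ j)\<^sup>2)"
proof (rule ccontr)
  assume less: "\<not> ?thesis"
  let ?x = "vec n (\<lambda>j. y $ j)"
  have val: "vec (Suc n) (\<lambda>l. if l = j then s else 0) \<bullet> z = s * z $ j" if "z \<in> carrier_vec (Suc n)" for z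
    using that j(1) by (simp add: scalar_prod_conv_sum[of _ "Suc n"] if_distrib[where f = "\<lambda>a. a * _"] cong: if_cong)
  have feas: "y \<in> carrier_vec (Suc n)" "(?x, y $ n) \<in> CR_ball_feasible n m X \<omega>" "\<delta> \<le> y $ n"
    using y by (auto simp: is_arg_min_def lifted_feasible_def)
  have xx: "?x \<bullet> ?x < 1"
    using less by (simp add: scalar_prod_conv_sum[of _ n] power2_eq_square)
  obtain t where t: "0 \<le> t" "(?x + t \<cdot>\<^sub>v d) \<bullet> (?x + t \<cdot>\<^sub>v d) = 1"
    using ray_meets_sphere[of ?x n d] xx d by auto
  have "t \<noteq> 0"
    using t(2) xx d(1) by (auto simp: scalar_prod_add_smult_self[of _ n])
  define z where "z = vec (Suc n) (\<lambda>l. if l < n then (?x + t \<cdot>\<^sub>v d) $ l else y $ n)"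
  have "vec n (\<lambda>l. z $ l) = ?x + t \<cdot>\<^sub>v d"
    using d(1) by (auto simp: z_def)
  moreover have "z $ n = y $ n"
    by (simp add: z_def)
  ultimately have "lifted_feasible n m X \<omega> \<delta> z"
    using CR_ball_feasible_add_smult[OF I feas(2) d(1,3) t] feas(3) by (simp add: lifted_feasible_def z_def)
  then have "s * y $ j \<le> s * z $ j"
    using y val feas(1) by (auto simp: is_arg_min_def lifted_feasible_def not_less)
  moreover have "z $ j = y $ j + t * d $ j"
    using j d(1) by (simp add: z_def)
  moreover have "t * (s * d $ j) < 0"
    using t(1) \<open>t \<noteq> 0\<close> j(2) by (simp add: mult_pos_neg)
  ultimately show False
    by (simp add: algebra_simps)
qed

text \<open>Together with \<open>cone_const\<close> this is the affine function \<open>\<omega> k *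
  (1 - 2 * (X k \<bullet> x) + \<parallel>X k\<parallel>^2) - \<zeta>\<close>, whose nonnegativity
  is constraint \<open>k\<close>; index \<open>n\<close> belongs to \<open>\<zeta>\<close>.\<close>

definition cone_coeff :: "nat \<Rightarrow> (nat \<Rightarrow> real vec) \<Rightarrow> (nat \<Rightarrow> real) \<Rightarrow> nat \<Rightarrow> nat \<Rightarrow> real" where
  "cone_coeff n X \<omega> k j = (if j < n then - 2 * (\<omega> k * X k $ j) else - 1)"

definition cone_const :: "nat \<Rightarrow> (nat \<Rightarrow> real vec) \<Rightarrow> (nat \<Rightarrow> real) \<Rightarrow> nat \<Rightarrow> real" where
  "cone_const n X \<omega> k = \<omega> k * (1 + (\<Sum>j<n. (X k $ j)\<^sup>2))"

text \<open>Cone \<open>m\<close> is the unit ball and cone \<open>m + 1\<close> is the constraint \<open>\<delta> \<le> \<zeta>\<close>.\<close>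

definition holds_relaxation ::
    "nat \<Rightarrow> nat \<Rightarrow> (nat \<Rightarrow> real vec) \<Rightarrow> (nat \<Rightarrow> real) \<Rightarrow> real \<Rightarrow> mem \<Rightarrow> bool" where
  "holds_relaxation n m X \<omega> \<delta> M \<longleftrightarrow>
     (\<forall>k i j. M ''A'' [k, i, j] = (if k = m \<and> i = j \<and> i < n then 1 else 0)) \<and>
     (\<forall>k i. M ''b'' [k, i] = 0) \<and>
     (\<forall>k j. M ''c'' [k, j] =
        (if k < m \<and> j \<le> n then cone_coeff n X \<omega> k j else if k = Suc m \<and> j = n then 1 else 0)) \<and>
     (\<forall>k<m. M ''d'' [k] = cone_const n X \<omega> k) \<and> M ''d'' [m] = 1 \<and> M ''d'' [Suc m] = - \<delta>"

text \<open>The left-hand sides vanish except in cone \<open>m\<close>, so the other cones are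
  linear inequalities. In cone \<open>m\<close> the matrix drops the entry \<open>\<zeta>\<close>,
  which leaves \<open>\<parallel>x\<parallel> \<le> 1\<close>.\<close>

lemma socp_feasible_query_iff:
  assumes I: "dispersion_instance n m X \<omega>" and M: "holds_relaxation n m X \<omega> \<delta> M"
  shows "socp_feasible (socp_query M (Suc n) (m + 2) n) y \<longleftrightarrow> lifted_feasible n m X \<omega> \<delta> y"
proof (cases "y \<in> carrier_vec (Suc n)")
  case False
  then show ?thesis
    by (simp add: socp_query_def lifted_feasible_def)
next
  case y: True
  let ?cone = "\<lambda>k. euclid_norm (mat n (Suc n) (\<lambda>(i, j). M ''A'' [k, i, j]) *\<^sub>v y + vec n (\<lambda>i. M ''b'' [k, i]))
      \<le> vec (Suc n) (\<lambda>j. M ''c'' [k, j]) \<bullet> y + M ''d'' [k]"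
  have lhs: "mat n (Suc n) (\<lambda>(i, j). M ''A'' [k, i, j]) *\<^sub>v y + vec n (\<lambda>i. M ''b'' [k, i]) =
      (if k = m then vec n (\<lambda>j. y $ j) else 0\<^sub>v n)" for k
    using y M unfolding holds_relaxation_def
    by (intro eq_vecI)
      (auto simp: scalar_prod_conv_sum[of _ "Suc n"] if_distrib[where f = "\<lambda>a. a * _"] cong: if_cong)
  have rhs: "vec (Suc n) (\<lambda>j. M ''c'' [k, j]) \<bullet> y =
      (\<Sum>j<n. M ''c'' [k, j] * y $ j) + M ''c'' [k, n] * y $ n" for k
    using y by (simp add: scalar_prod_conv_sum[of _ "Suc n"])
  have cone_less: "?cone k \<longleftrightarrow>
      y $ n \<le> \<omega> k * (1 - 2 * (\<Sum>j<n. X k $ j * y $ j) + (\<Sum>j<n. (X k $ j)\<^sup>2))" if "k < m" for k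
  proof -
    have "(\<Sum>j<n. M ''c'' [k, j] * y $ j) = - 2 * \<omega> k * (\<Sum>j<n. X k $ j * y $ j)"
      using that M by (simp add: holds_relaxation_def cone_coeff_def sum_distrib_left mult.assoc)
    moreover have "M ''c'' [k, n] = - 1" "M ''d'' [k] = cone_const n X \<omega> k"
      using that M by (simp_all add: holds_relaxation_def cone_coeff_def)
    ultimately show ?thesis
      using that by (simp add: lhs rhs euclid_norm_zero cone_const_def algebra_simps)
  qed
  have cone_m: "?cone m \<longleftrightarrow> (\<Sum>j<n. (y $ j)\<^sup>2) \<le> 1"
    unfolding lhs rhs using M by (simp add: holds_relaxation_def euclid_norm_le_1_iff
        scalar_prod_conv_sum[of _ n] power2_eq_square)
  have cone_Suc: "?cone (Suc m) \<longleftrightarrow> \<delta> \<le> y $ n"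
    unfolding lhs rhs using M by (simp add: holds_relaxation_def euclid_norm_zero)
  have "socp_feasible (socp_query M (Suc n) (m + 2) n) y \<longleftrightarrow> (\<forall>k<m + 2. ?cone k)"
    using y by (auto simp: socp_query_def simp del: upt_Suc)
  also have "\<dots> \<longleftrightarrow> (\<forall>k<m. ?cone k) \<and> ?cone m \<and> ?cone (Suc m)"
    by (auto simp: less_Suc_eq)
  also have "\<dots> \<longleftrightarrow> lifted_feasible n m X \<omega> \<delta> y"
    using cone_less cone_m cone_Suc y by (auto simp: lifted_feasible_iff[OF I])
  finally show ?thesis .
qed

text \<open>The guarantee on \<open>slv\<close> concerns programs with an optimum; \<open>y0\<close>
  makes this one feasible, and compactness then supplies an optimum.\<close>

lemma solver_minimises:
  assumes slv: "poly_time_socp_solver slv cst"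
    and I: "dispersion_instance n m X \<omega>" and M: "holds_relaxation n m X \<omega> \<delta> M"
    and y0: "lifted_feasible n m X \<omega> \<delta> y0"
  shows "is_arg_min (\<lambda>y. vec (Suc n) (\<lambda>j. M ''obj'' [j]) \<bullet> y) (lifted_feasible n m X \<omega> \<delta>)
    (slv (socp_query M (Suc n) (m + 2) n))"
proof -
  let ?I = "socp_query M (Suc n) (m + 2) n"
  have "socp_feasible ?I = lifted_feasible n m X \<omega> \<delta>" "fst ?I = vec (Suc n) (\<lambda>j. M ''obj'' [j])"
    using socp_feasible_query_iff[OF I M] by (auto simp: socp_query_def)
  then have *: "socp_optimal ?I y \<longleftrightarrow>
      is_arg_min (\<lambda>y. vec (Suc n) (\<lambda>j. M ''obj'' [j]) \<bullet> y) (lifted_feasible n m X \<omega> \<delta>) y" for y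
    by (simp add: socp_optimal_def)
  have "\<exists>y. socp_optimal ?I y"
    unfolding * by (rule lifted_optimum_exists[OF I y0])
  then have "socp_optimal ?I (slv ?I)"
    using slv unfolding poly_time_socp_solver_def by blast
  then show ?thesis
    unfolding * .
qed

section \<open>Timed execution of programs\<close>

text \<open>A weakest precondition for total correctness, with the elapsed time passed to
  \<open>Q\<close>. In this form the rules for loop-free commands are equations.\<close>

definition runs ::
    "(socp \<Rightarrow> real vec) \<Rightarrow> (socp \<Rightarrow> nat) \<Rightarrow> com \<Rightarrow> state \<Rightarrow> (nat \<Rightarrow> state \<Rightarrow> bool) \<Rightarrow> bool" where
  "runs slv cst p s Q \<longleftrightarrow> (\<exists>t s'. exec slv cst p s t s' \<and> Q t s')"

lemma runs_mono:
  assumes "runs slv cst p s Q" "\<And>t r M. Q t (r, M) \<Longrightarrow> Q' t (r, M)"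
  shows "runs slv cst p s Q'"
proof -
  obtain t r M where "exec slv cst p s t (r, M)" "Q t (r, M)"
    using assms(1) unfolding runs_def by (elim exE conjE) (metis surj_pair)
  with assms(2) show ?thesis
    unfolding runs_def by (intro exI conjI)
qed

inductive_simps exec_simps:
  "exec slv cst Skip s t s'"
  "exec slv cst (SetReg v e) (r, M) t s'"
  "exec slv cst (SetCell a es e) s t s'"
  "exec slv cst (Seq p q) s t s'"
  "exec slv cst (If b p q) s t s'"

lemma runs_Skip [simp]: "runs slv cst Skip s Q \<longleftrightarrow> Q 1 s"
  by (simp add: runs_def exec_simps del: split_paired_Ex)

lemma runs_SetReg [simp]: "runs slv cst (SetReg v e) (r, M) Q \<longleftrightarrow> Q 1 (r(v := ival e r), M)"
  by (simp add: runs_def exec_simps del: split_paired_Ex)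

lemma runs_SetCell [simp]:
  "runs slv cst (SetCell a es e) (r, M) Q \<longleftrightarrow>
     Q 1 (r, M(a := (M a)(map (\<lambda>e. ival e r) es := rval e (r, M))))"
  by (simp add: runs_def exec_simps del: split_paired_Ex)

lemma runs_SolveSOCP [simp]:
  "runs slv cst (SolveSOCP eN eK eR) (r, M) Q \<longleftrightarrow>
     (let I = socp_query M (ival eN r) (ival eK r) (ival eR r)
      in Q (1 + socp_size I + cst I) (r, store_solution (ival eN r) (slv I) M))"
  unfolding runs_def Let_def
  using exec.SolveSOCP[OF refl, of slv cst eN eK eR r M] by (auto elim: exec.cases)

lemma runs_Seq [simp]:
  "runs slv cst (Seq p q) s Q \<longleftrightarrow> runs slv cst p s (\<lambda>t s'. runs slv cst q s' (\<lambda>t' s''. Q (t + t') s''))"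
proof
  assume "runs slv cst (Seq p q) s Q"
  then obtain t s'' where "exec slv cst (Seq p q) s t s''" and Q: "Q t s''"
    unfolding runs_def by (elim exE conjE)
  then obtain t1 t2 s' where t: "t = t1 + t2" "exec slv cst p s t1 s'" "exec slv cst q s' t2 s''"
    unfolding exec_simps by (elim exE conjE)
  show "runs slv cst p s (\<lambda>t s'. runs slv cst q s' (\<lambda>t' s''. Q (t + t') s''))"
    unfolding runs_def using t Q by (intro exI conjI) simp_all
next
  assume "runs slv cst p s (\<lambda>t s'. runs slv cst q s' (\<lambda>t' s''. Q (t + t') s''))"
  then obtain t t' s' s'' where "exec slv cst p s t s'" "exec slv cst q s' t' s''" and Q: "Q (t + t') s''"
    unfolding runs_def by (elim exE conjE)
  from exec.Seq[OF this(1,2)] Q show "runs slv cst (Seq p q) s Q"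
    unfolding runs_def by (intro exI conjI)
qed

lemma runs_If [simp]:
  "runs slv cst (If b p q) s Q \<longleftrightarrow>
     (if bval b s then runs slv cst p s (\<lambda>t. Q (1 + t)) else runs slv cst q s (\<lambda>t. Q (1 + t)))"
proof -
  have "exec slv cst (If b p q) s t s' \<longleftrightarrow> (\<exists>t'. t = 1 + t' \<and> exec slv cst (if bval b s then p else q) s t' s')"
    for t s'
    by (simp add: exec_simps)
  then have "runs slv cst (If b p q) s Q \<longleftrightarrow> runs slv cst (if bval b s then p else q) s (\<lambda>t. Q (1 + t))"
    unfolding runs_def by (auto simp del: split_paired_Ex)
  then show ?thesis
    by simp
qed

definition for_loop :: "string \<Rightarrow> iexp \<Rightarrow> com \<Rightarrow> com" where
  "for_loop v e p =
     Seq (SetReg v (INum 0))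
       (While (ILess (IReg v) e) (Seq p (SetReg v (IAdd (IReg v) (INum 1)))))"

text \<open>A pass costs at most \<open>T\<close> for the body, plus one test and one increment; the
  remaining \<open>2\<close> pay for the initialisation and the failing last test. The bound
  \<open>e\<close> is re-evaluated at every test, so the invariant must fix its value.\<close>

lemma runs_for_loop:
  assumes init: "Inv 0 (r(v := 0)) M"
    and counter: "\<And>k r M. Inv k r M \<Longrightarrow> r v = k \<and> ival e r = N"
    and step: "\<And>k r M. k < N \<Longrightarrow> Inv k r M \<Longrightarrow>
      runs slv cst p (r, M) (\<lambda>t s. t \<le> T \<and> fst s v = k \<and> Inv (Suc k) ((fst s)(v := Suc k)) (snd s))"
    and post: "\<And>t r M. t \<le> 2 + N * (T + 2) \<Longrightarrow> Inv N r M \<Longrightarrow> Q t (r, M)"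
  shows "runs slv cst (for_loop v e p) (r, M) Q"
proof -
  let ?W = "While (ILess (IReg v) e) (Seq p (SetReg v (IAdd (IReg v) (INum 1))))"
  have while: "\<exists>t r' M'. exec slv cst ?W (r, M) t (r', M') \<and> t \<le> 1 + (N - k) * (T + 2) \<and> Inv N r' M'"
    if "Inv k r M" "k \<le> N" for k r M
    using that
  \<comment> \<open>Induction on the number of passes still to come.\<close>
  proof (induction "N - k" arbitrary: k r M)
    case 0
    then have k: "k = N"
      by simp
    then have "\<not> bval (ILess (IReg v) e) (r, M)"
      using counter[OF 0(2)] by simp
    from exec.WhileFalse[OF this, of slv cst] show ?case
      using 0(2) k by (metis le_add1)
  next
    case (Suc i)
    then have "k < N"
      by simp
    then have b: "bval (ILess (IReg v) e) (r, M)"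
      using counter[OF Suc.prems(1)] by simp
    from step[OF \<open>k < N\<close> Suc.prems(1)] obtain t r1 M1 where
      p: "exec slv cst p (r, M) t (r1, M1)" "t \<le> T" "r1 v = k" "Inv (Suc k) (r1(v := Suc k)) M1"
      unfolding runs_def by (metis fst_conv snd_conv surj_pair)
    have "exec slv cst (SetReg v (IAdd (IReg v) (INum 1))) (r1, M1) 1 (r1(v := Suc k), M1)"
      using exec.SetReg[of slv cst v "IAdd (IReg v) (INum 1)" r1 M1] p(3) by simp
    note body = exec.Seq[OF p(1) this]
    have "i = N - Suc k" "Suc k \<le> N"
      using Suc.hyps(2) by simp_all
    from Suc.hyps(1)[OF this(1) p(4) this(2)]
    obtain t' r' M' where w: "exec slv cst ?W (r1(v := Suc k), M1) t' (r', M')"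
      "t' \<le> 1 + (N - Suc k) * (T + 2)" "Inv N r' M'"
      by blast
    have "N - k = Suc (N - Suc k)"
      using \<open>k < N\<close> by simp
    then have "1 + (t + 1) + t' \<le> 1 + (N - k) * (T + 2)"
      using p(2) w(2) by simp
    then show ?case
      using exec.WhileTrue[OF b body w(1)] w(3) by blast
  qed
  obtain t r' M' where w: "exec slv cst ?W (r(v := 0), M) t (r', M')" "t \<le> 1 + N * (T + 2)" "Inv N r' M'"
    using while[OF init le0] unfolding diff_zero by blast
  have "exec slv cst (SetReg v (INum 0)) (r, M) 1 (r(v := 0), M)"
    using exec.SetReg[of slv cst v "INum 0" r M] by simp
  from exec.Seq[OF this w(1)] show ?thesis
    unfolding runs_def for_loop_def using post[of "1 + t" r' M'] w(2,3) by fastforce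
qed

section \<open>Programs that set up and solve the cone programs\<close>

definition fill_cone :: com where
  "fill_cone =
     Seq (SetCell ''d'' [IReg ''i''] (RNum 1))
    (Seq (for_loop ''j'' (IReg ''n'')
       (Seq (SetCell ''c'' [IReg ''i'', IReg ''j'']
              (RMul (RNum (- 2)) (RMul (RCell ''w'' [IReg ''i'']) (RCell ''x'' [IReg ''i'', IReg ''j'']))))
            (SetCell ''d'' [IReg ''i'']
              (RAdd (RCell ''d'' [IReg ''i''])
                (RMul (RCell ''x'' [IReg ''i'', IReg ''j'']) (RCell ''x'' [IReg ''i'', IReg ''j'']))))))
    (Seq (SetCell ''d'' [IReg ''i''] (RMul (RCell ''w'' [IReg ''i'']) (RCell ''d'' [IReg ''i''])))
         (SetCell ''c'' [IReg ''i'', IReg ''n''] (RNum (- 1)))))"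

text \<open>In the loop the cell \<open>d [k]\<close> collects \<open>1\<close> plus the squares of
  the entries of \<open>X k\<close>; the weight is multiplied in afterwards. The loop takes at most
  \<open>2 + n * (2 + 2)\<close>, the assignments outside it \<open>3\<close>.\<close>

lemma runs_fill_cone:
  assumes r: "r ''n'' = n" "r ''i'' = k"
    and M: "M ''w'' [k] = \<omega> k" "\<And>j. j < n \<Longrightarrow> M ''x'' [k, j] = X k $ j"
  shows "runs slv cst fill_cone (r, M) (\<lambda>t s. t \<le> 5 + 4 * n \<and> (\<forall>v. v \<noteq> ''j'' \<longrightarrow> fst s v = r v) \<and>
    (\<forall>a. a \<noteq> ''c'' \<and> a \<noteq> ''d'' \<longrightarrow> snd s a = M a) \<and>
    (\<forall>i l. snd s ''c'' [i, l] = (if i = k \<and> l \<le> n then cone_coeff n X \<omega> k l else M ''c'' [i, l])) \<and>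
    (\<forall>i. snd s ''d'' [i] = (if i = k then cone_const n X \<omega> k else M ''d'' [i])))"
proof -
  define Inv where "Inv j r' M' \<longleftrightarrow> (\<forall>v. v \<noteq> ''j'' \<longrightarrow> r' v = r v) \<and> r' ''j'' = j \<and>
    (\<forall>a. a \<noteq> ''c'' \<and> a \<noteq> ''d'' \<longrightarrow> M' a = M a) \<and>
    (\<forall>i l. M' ''c'' [i, l] = (if i = k \<and> l < j then cone_coeff n X \<omega> k l else M ''c'' [i, l])) \<and>
    (\<forall>i. M' ''d'' [i] = (if i = k then 1 + (\<Sum>l<j. (X k $ l)\<^sup>2) else M ''d'' [i]))"
    for j and r' :: regs and M' :: mem
  show ?thesis
    unfolding fill_cone_def runs_Seq runs_SetCell
    by (rule runs_for_loop[where Inv = Inv and N = n and T = 2])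
      (use r M in \<open>auto simp: Inv_def cone_coeff_def cone_const_def power2_eq_square\<close>)
qed

text \<open>Cells not written are \<open>0\<close> in the encoded input, so only nonzero entries are
  stored. In particular \<open>d [m + 1]\<close> stays \<open>0\<close>, which makes the last cone
  \<open>0 \<le> \<zeta>\<close>. Programs minimise, so the entry \<open>-1\<close> asks for the
  largest \<open>\<zeta>\<close>.\<close>

definition build_query :: com where
  "build_query =
     Seq (for_loop ''i'' (IReg ''m'') fill_cone)
    (Seq (for_loop ''j'' (IReg ''n'') (SetCell ''A'' [IReg ''m'', IReg ''j'', IReg ''j''] (RNum 1)))
    (Seq (SetCell ''d'' [IReg ''m''] (RNum 1))
    (Seq (SetCell ''c'' [IAdd (IReg ''m'') (INum 1), IReg ''n''] (RNum 1))
         (SetCell ''obj'' [IReg ''n''] (RNum (- 1))))))"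

text \<open>The first loop alters only the arrays \<open>c\<close> and \<open>d\<close>, so the
  input stays readable for every cone. The constant \<open>7\<close> is \<open>2\<close> for each
  loop and \<open>3\<close> for the final assignments.\<close>

lemma runs_build_query:
  assumes "encode_dispersion (n, m, X, \<omega>) = (r, M)"
  shows "runs slv cst build_query (r, M) (\<lambda>t s. t \<le> 7 + m * (7 + 4 * n) + 3 * n \<and>
    fst s ''n'' = n \<and> fst s ''m'' = m \<and> holds_relaxation n m X \<omega> 0 (snd s) \<and>
    (\<forall>j. snd s ''obj'' [j] = (if j = n then - 1 else 0)))"
proof -
  have r: "r ''n'' = n" "r ''m'' = m"
    and M: "\<And>k. k < m \<Longrightarrow> M ''w'' [k] = \<omega> k" "\<And>k j. k < m \<Longrightarrow> j < n \<Longrightarrow> M ''x'' [k, j] = X k $ j"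
      "\<And>k i j. M ''A'' [k, i, j] = 0" "\<And>k i. M ''b'' [k, i] = 0" "\<And>k j. M ''c'' [k, j] = 0"
      "\<And>k. M ''d'' [k] = 0" "\<And>k. M ''obj'' [k] = 0"
    using assms by auto
  define Inv where "Inv k r' M' \<longleftrightarrow> r' ''n'' = n \<and> r' ''m'' = m \<and> r' ''i'' = k \<and>
    (\<forall>a. a \<noteq> ''c'' \<and> a \<noteq> ''d'' \<longrightarrow> M' a = M a) \<and>
    (\<forall>i l. M' ''c'' [i, l] = (if i < k \<and> l \<le> n then cone_coeff n X \<omega> i l else 0)) \<and>
    (\<forall>i. M' ''d'' [i] = (if i < k then cone_const n X \<omega> i else 0))" for k and r' :: regs and M' :: mem
  define Inv2 where "Inv2 j r' M' \<longleftrightarrow> r' ''n'' = n \<and> r' ''m'' = m \<and> r' ''j'' = j \<and>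
    (\<forall>k i l. M' ''A'' [k, i, l] = (if k = m \<and> i = l \<and> i < j then 1 else 0)) \<and>
    (\<forall>a. a \<noteq> ''A'' \<and> a \<noteq> ''c'' \<and> a \<noteq> ''d'' \<longrightarrow> M' a = M a) \<and>
    (\<forall>i l. M' ''c'' [i, l] = (if i < m \<and> l \<le> n then cone_coeff n X \<omega> i l else 0)) \<and>
    (\<forall>i. M' ''d'' [i] = (if i < m then cone_const n X \<omega> i else 0))" for j and r' :: regs and M' :: mem
  show ?thesis
    unfolding build_query_def runs_Seq
  proof (rule runs_for_loop[where Inv = Inv and N = m and T = "5 + 4 * n"])
    fix k r' M' assume "k < m" and Inv: "Inv k r' M'"
    then have "runs slv cst fill_cone (r', M') (\<lambda>t s. t \<le> 5 + 4 * n \<and> (\<forall>v. v \<noteq> ''j'' \<longrightarrow> fst s v = r' v) \<and>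
      (\<forall>a. a \<noteq> ''c'' \<and> a \<noteq> ''d'' \<longrightarrow> snd s a = M' a) \<and>
      (\<forall>i l. snd s ''c'' [i, l] = (if i = k \<and> l \<le> n then cone_coeff n X \<omega> k l else M' ''c'' [i, l])) \<and>
      (\<forall>i. snd s ''d'' [i] = (if i = k then cone_const n X \<omega> k else M' ''d'' [i])))"
      using M by (intro runs_fill_cone) (auto simp: Inv_def)
    then show "runs slv cst fill_cone (r', M')
      (\<lambda>t s. t \<le> 5 + 4 * n \<and> fst s ''i'' = k \<and> Inv (Suc k) ((fst s)(''i'' := Suc k)) (snd s))"
      by (rule runs_mono) (use Inv in \<open>auto simp: Inv_def\<close>)
  next
    fix t r' M' assume t: "t \<le> 2 + m * (5 + 4 * n + 2)" and Inv: "Inv m r' M'"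
    show "runs slv cst (for_loop ''j'' (IReg ''n'') (SetCell ''A'' [IReg ''m'', IReg ''j'', IReg ''j''] (RNum 1)))
      (r', M') (\<lambda>t' s'. runs slv cst (SetCell ''d'' [IReg ''m''] (RNum 1)) s' (\<lambda>t'' s''.
        runs slv cst (SetCell ''c'' [IAdd (IReg ''m'') (INum 1), IReg ''n''] (RNum 1)) s'' (\<lambda>t''' s'''.
        runs slv cst (SetCell ''obj'' [IReg ''n''] (RNum (- 1))) s''' (\<lambda>t4 s.
          t + (t' + (t'' + (t''' + t4))) \<le> 7 + m * (7 + 4 * n) + 3 * n \<and>
          fst s ''n'' = n \<and> fst s ''m'' = m \<and> holds_relaxation n m X \<omega> 0 (snd s) \<and>
          (\<forall>j. snd s ''obj'' [j] = (if j = n then - 1 else 0))))))"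
      by (rule runs_for_loop[where Inv = Inv2 and N = n and T = 1])
        (use t Inv M in \<open>auto simp: Inv_def Inv2_def holds_relaxation_def\<close>)
  qed (use r M in \<open>auto simp: Inv_def\<close>)
qed

text \<open>The \<open>n + 1\<close> variables are \<open>(x, \<zeta>)\<close>; \<open>n\<close>
  rows are what the ball constraint requires.\<close>

definition solve_relaxation :: com where
  "solve_relaxation = SolveSOCP (IAdd (IReg ''n'') (INum 1)) (IAdd (IReg ''m'') (INum 2)) (IReg ''n'')"

text \<open>A failed attempt leaves \<open>out\<close> alone, so that an optimum found earlier
  survives. The squared norm is compared with \<open>1\<close>, which avoids a square root.\<close>

definition try_objective :: com where
  "try_objective =
     Seq solve_relaxation
    (Seq (SetCell ''nrm'' [] (RNum 0))
    (Seq (for_loop ''k'' (IReg ''n'')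
           (SetCell ''nrm'' []
             (RAdd (RCell ''nrm'' []) (RMul (RCell ''sol'' [IReg ''k'']) (RCell ''sol'' [IReg ''k''])))))
         (If (RLess (RCell ''nrm'' []) (RNum 1)) Skip
           (for_loop ''k'' (IReg ''n'') (SetCell ''out'' [IReg ''k''] (RCell ''sol'' [IReg ''k'']))))))"

text \<open>Besides the call, bounded by \<open>C\<close>, there are two loops of at most
  \<open>2 + 3 * n\<close> each, the reset of \<open>nrm\<close> and the test.\<close>

lemma runs_try_objective:
  fixes M :: mem and n m :: nat
  defines "I \<equiv> socp_query M (Suc n) (m + 2) n"
  assumes r: "r ''n'' = n" "r ''m'' = m" and C: "1 + socp_size I + cst I \<le> C"
  shows "runs slv cst try_objective (r, M) (\<lambda>t s. t \<le> C + 6 * n + 6 \<and>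
    (\<forall>v. v \<noteq> ''k'' \<longrightarrow> fst s v = r v) \<and>
    (\<forall>a. a \<noteq> ''sol'' \<and> a \<noteq> ''nrm'' \<and> a \<noteq> ''out'' \<longrightarrow> snd s a = M a) \<and>
    (\<forall>j<n. snd s ''out'' [j] = (if (\<Sum>l<n. (slv I $ l)\<^sup>2) < 1 then M ''out'' [j] else slv I $ j)))"
proof -
  let ?M = "store_solution (Suc n) (slv I) M"
  have sol: "?M ''sol'' [j] = slv I $ j" if "j < n" for j
    using that by (simp add: store_solution_def)
  have store: "?M a = M a" if "a \<noteq> ''sol''" for a
    using that by (simp add: store_solution_def)
  define Inv where "Inv k r' M' \<longleftrightarrow> (\<forall>v. v \<noteq> ''k'' \<longrightarrow> r' v = r v) \<and> r' ''k'' = k \<and>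
    (\<forall>a. a \<noteq> ''nrm'' \<longrightarrow> M' a = ?M a) \<and> M' ''nrm'' [] = (\<Sum>l<k. (slv I $ l)\<^sup>2)"
    for k and r' :: regs and M' :: mem
  define Inv2 where "Inv2 k r' M' \<longleftrightarrow> (\<forall>v. v \<noteq> ''k'' \<longrightarrow> r' v = r v) \<and> r' ''k'' = k \<and>
    (\<forall>a. a \<noteq> ''nrm'' \<and> a \<noteq> ''out'' \<longrightarrow> M' a = ?M a) \<and> (\<forall>l<k. M' ''out'' [l] = slv I $ l)"
    for k and r' :: regs and M' :: mem
  let ?Q = "\<lambda>t s. t \<le> C + 6 * n + 6 \<and>
    (\<forall>v. v \<noteq> ''k'' \<longrightarrow> fst s v = r v) \<and>
    (\<forall>a. a \<noteq> ''sol'' \<and> a \<noteq> ''nrm'' \<and> a \<noteq> ''out'' \<longrightarrow> snd s a = M a) \<and>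
    (\<forall>j<n. snd s ''out'' [j] = (if (\<Sum>l<n. (slv I $ l)\<^sup>2) < 1 then M ''out'' [j] else slv I $ j))"
  have copy: "runs slv cst (If (RLess (RCell ''nrm'' []) (RNum 1)) Skip
      (for_loop ''k'' (IReg ''n'') (SetCell ''out'' [IReg ''k''] (RCell ''sol'' [IReg ''k''])))) (r', M')
      (\<lambda>t'. ?Q (t + t'))" if t: "t \<le> C + 3 * n + 3" and Inv: "Inv n r' M'" for t r' M'
  proof (cases "(\<Sum>l<n. (slv I $ l)\<^sup>2) < 1")
    case True
    with t Inv show ?thesis
      by (simp add: Inv_def store)
  next
    case False
    have "runs slv cst (for_loop ''k'' (IReg ''n'') (SetCell ''out'' [IReg ''k''] (RCell ''sol'' [IReg ''k'']))) (r', M')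
      (\<lambda>t'. ?Q (t + (1 + t')))"
      by (rule runs_for_loop[where Inv = Inv2 and N = n and T = 1])
        (use t Inv r False in \<open>auto simp: Inv_def Inv2_def sol store less_Suc_eq\<close>)
    with False Inv show ?thesis
      by (simp add: Inv_def)
  qed
  have "runs slv cst (for_loop ''k'' (IReg ''n'')
      (SetCell ''nrm'' []
        (RAdd (RCell ''nrm'' []) (RMul (RCell ''sol'' [IReg ''k'']) (RCell ''sol'' [IReg ''k''])))))
      (r, ?M(''nrm'' := (?M ''nrm'')([] := 0)))
      (\<lambda>t s. runs slv cst (If (RLess (RCell ''nrm'' []) (RNum 1)) Skip
        (for_loop ''k'' (IReg ''n'') (SetCell ''out'' [IReg ''k''] (RCell ''sol'' [IReg ''k''])))) s
        (\<lambda>t'. ?Q (1 + socp_size I + cst I + (1 + (t + t')))))"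
  proof (rule runs_for_loop[where Inv = Inv and N = n and T = 1])
    fix t r' M' assume "t \<le> 2 + n * (1 + 2)" "Inv n r' M'"
    then show "runs slv cst (If (RLess (RCell ''nrm'' []) (RNum 1)) Skip
        (for_loop ''k'' (IReg ''n'') (SetCell ''out'' [IReg ''k''] (RCell ''sol'' [IReg ''k''])))) (r', M')
        (\<lambda>t'. ?Q (1 + socp_size I + cst I + (1 + (t + t'))))"
      using copy[of "1 + socp_size I + cst I + (1 + t)" r' M'] C by (simp add: add.assoc)
  qed (use r in \<open>auto simp: Inv_def sol power2_eq_square\<close>)
  moreover have "socp_query M (Suc n) (Suc (Suc m)) n = I"
    by (simp add: I_def)
  ultimately show ?thesis
    unfolding try_objective_def solve_relaxation_def using r
    by (simp add: Let_def del: runs_If)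
qed

section \<open>The search for an optimum on the sphere\<close>

text \<open>If the answer passes the norm test, it is optimal whatever \<open>out\<close> held
  before. If it fails, \<open>out\<close> is unchanged and \<open>minimiser_on_sphere\<close> rules
  out \<open>s * d $ j < 0\<close>, so the earlier output must have been optimal.\<close>

lemma runs_try_coordinate:
  assumes slv: "poly_time_socp_solver slv cst"
    and C: "\<And>M. 1 + socp_size (socp_query M (Suc n) (m + 2) n) + cst (socp_query M (Suc n) (m + 2) n) \<le> C"
    and I: "dispersion_instance n m X \<omega>"
    and d: "d \<in> carrier_vec n" "d \<noteq> 0\<^sub>v n" "\<forall>i<m. X i \<bullet> d \<le> 0"
    and ub: "\<forall>(x, \<zeta>) \<in> CR_ball_feasible n m X \<omega>. \<zeta> \<le> \<delta>"
    and y0: "lifted_feasible n m X \<omega> \<delta> y0"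
    and r: "r ''n'' = n" "r ''m'' = m" and j: "j < n"
    and M: "holds_relaxation n m X \<omega> \<delta> M" "\<And>l. M ''obj'' [l] = (if l = j then s else 0)"
  shows "runs slv cst try_objective (r, M) (\<lambda>t S. t \<le> C + 6 * n + 6 \<and>
    (\<forall>v. v \<noteq> ''k'' \<longrightarrow> fst S v = r v) \<and>
    (\<forall>a. a \<noteq> ''sol'' \<and> a \<noteq> ''nrm'' \<and> a \<noteq> ''out'' \<longrightarrow> snd S a = M a) \<and>
    (P_ball_optimal n m X \<omega> (vec n (\<lambda>l. M ''out'' [l])) \<or> s * d $ j < 0 \<longrightarrow>
      P_ball_optimal n m X \<omega> (vec n (\<lambda>l. snd S ''out'' [l]))))"
proof -
  let ?y = "slv (socp_query M (Suc n) (m + 2) n)"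
  have "is_arg_min (\<lambda>y. vec (Suc n) (\<lambda>l. if l = j then s else 0) \<bullet> y) (lifted_feasible n m X \<omega> \<delta>) ?y"
    using solver_minimises[OF slv I M(1) y0] by (simp only: M(2))
  note min = this minimiser_on_sphere[OF I d j _ this]
  have feas: "lifted_feasible n m X \<omega> \<delta> ?y"
    using min(1) by (simp only: is_arg_min_def)
  have opt: "P_ball_optimal n m X \<omega> (vec n (\<lambda>l. ?y $ l))" if "\<not> (\<Sum>l<n. (?y $ l)\<^sup>2) < 1"
    by (rule P_ball_optimal_if_on_sphere[OF I ub feas]) (use that in \<open>simp_all only: not_less\<close>)
  show ?thesis
  proof (rule runs_mono[OF runs_try_objective[where slv = slv and cst = cst and M = M, OF r C]])
    fix t r' M'
    assume *: "t \<le> C + 6 * n + 6 \<and> (\<forall>v. v \<noteq> ''k'' \<longrightarrow> fst (r', M') v = r v) \<and>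
      (\<forall>a. a \<noteq> ''sol'' \<and> a \<noteq> ''nrm'' \<and> a \<noteq> ''out'' \<longrightarrow> snd (r', M') a = M a) \<and>
      (\<forall>j<n. snd (r', M') ''out'' [j] = (if (\<Sum>l<n. (?y $ l)\<^sup>2) < 1 then M ''out'' [j] else ?y $ j))"
    have "P_ball_optimal n m X \<omega> (vec n (\<lambda>l. M' ''out'' [l]))"
      if prev: "P_ball_optimal n m X \<omega> (vec n (\<lambda>l. M ''out'' [l])) \<or> s * d $ j < 0"
    proof (cases "(\<Sum>l<n. (?y $ l)\<^sup>2) < 1")
      case True
      then have "vec n (\<lambda>l. M' ''out'' [l]) = vec n (\<lambda>l. M ''out'' [l])"
        using * by (intro eq_vecI) simp_all
      moreover have "\<not> s * d $ j < 0"
        using True min(2) by (meson not_le)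
      ultimately show ?thesis
        using prev by simp
    next
      case False
      then have "vec n (\<lambda>l. M' ''out'' [l]) = vec n (\<lambda>l. ?y $ l)"
        using * by (intro eq_vecI) simp_all
      then show ?thesis
        using opt[OF False] by simp
    qed
    with * show "t \<le> C + 6 * n + 6 \<and> (\<forall>v. v \<noteq> ''k'' \<longrightarrow> fst (r', M') v = r v) \<and>
      (\<forall>a. a \<noteq> ''sol'' \<and> a \<noteq> ''nrm'' \<and> a \<noteq> ''out'' \<longrightarrow> snd (r', M') a = M a) \<and>
      (P_ball_optimal n m X \<omega> (vec n (\<lambda>l. M ''out'' [l])) \<or> s * d $ j < 0 \<longrightarrow>
        P_ball_optimal n m X \<omega> (vec n (\<lambda>l. snd (r', M') ''out'' [l])))"
      by simp
  qed
qed

text \<open>The objective \<open>-1\<close> maximises the coordinate and \<open>1\<close> minimises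
  it. Resetting the cell to \<open>0\<close> leaves a clean objective for the next
  coordinate.\<close>

definition search_sphere :: com where
  "search_sphere = for_loop ''j'' (IReg ''n'')
     (Seq (SetCell ''obj'' [IReg ''j''] (RNum (- 1)))
     (Seq try_objective
     (Seq (SetCell ''obj'' [IReg ''j''] (RNum 1))
     (Seq try_objective
          (SetCell ''obj'' [IReg ''j''] (RNum 0))))))"

text \<open>The direction \<open>d\<close> occurs only in the invariant, never in the program:
  \<open>out\<close> is optimal as soon as a nonzero entry of \<open>d\<close> has been passed, and
  \<open>d \<noteq> 0\<close> has one. A pass consists of two attempts and three
  assignments.\<close>

lemma runs_search_sphere:
  assumes slv: "poly_time_socp_solver slv cst"
    and C: "\<And>M. 1 + socp_size (socp_query M (Suc n) (m + 2) n) + cst (socp_query M (Suc n) (m + 2) n) \<le> C"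
    and I: "dispersion_instance n m X \<omega>" and sol: "has_nonzero_solution n m X"
    and ub: "\<forall>(x, \<zeta>) \<in> CR_ball_feasible n m X \<omega>. \<zeta> \<le> \<delta>"
    and y0: "lifted_feasible n m X \<omega> \<delta> y0"
    and r: "r ''n'' = n" "r ''m'' = m"
    and M: "holds_relaxation n m X \<omega> \<delta> M" "\<And>l. M ''obj'' [l] = 0"
  shows "runs slv cst search_sphere (r, M) (\<lambda>t S. t \<le> 2 + n * (2 * C + 12 * n + 17) \<and>
    P_ball_optimal n m X \<omega> (vec n (\<lambda>l. snd S ''out'' [l])))"
proof -
  obtain d where d: "d \<in> carrier_vec n" "d \<noteq> 0\<^sub>v n" "\<forall>i<m. X i \<bullet> d \<le> 0"
    using sol by (auto simp: has_nonzero_solution_def)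
  define Inv where "Inv j r' M' \<longleftrightarrow> r' ''n'' = n \<and> r' ''m'' = m \<and> r' ''j'' = j \<and>
    holds_relaxation n m X \<omega> \<delta> M' \<and> (\<forall>l. M' ''obj'' [l] = 0) \<and>
    ((\<exists>l<j. d $ l \<noteq> 0) \<longrightarrow> P_ball_optimal n m X \<omega> (vec n (\<lambda>l. M' ''out'' [l])))"
    for j and r' :: regs and M' :: mem
  note attempt = runs_try_coordinate[OF slv C I d ub y0]
  have relax_cong: "holds_relaxation n m X \<omega> \<delta> M2"
    if "holds_relaxation n m X \<omega> \<delta> M1" "M2 ''A'' = M1 ''A''" "M2 ''b'' = M1 ''b''" "M2 ''c'' = M1 ''c''"
      "M2 ''d'' = M1 ''d''" for M1 M2
    using that by (simp add: holds_relaxation_def)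
  show ?thesis
    unfolding search_sphere_def
  proof (rule runs_for_loop[where Inv = Inv and N = n and T = "2 * C + 12 * n + 15"])
    fix j r1 M1 assume j: "j < n" and Inv: "Inv j r1 M1"
    have r1: "r1 ''n'' = n" "r1 ''m'' = m" "r1 ''j'' = j"
      and relax1: "holds_relaxation n m X \<omega> \<delta> M1" and obj1: "\<And>l. M1 ''obj'' [l] = 0"
      and out1: "\<exists>l<j. d $ l \<noteq> 0 \<Longrightarrow> P_ball_optimal n m X \<omega> (vec n (\<lambda>l. M1 ''out'' [l]))"
      using Inv by (simp_all add: Inv_def)
    let ?M1 = "M1(''obj'' := (M1 ''obj'')([j] := - 1))"
    have "runs slv cst try_objective (r1, ?M1)
      (\<lambda>t s'. runs slv cst (SetCell ''obj'' [IReg ''j''] (RNum 1)) s' (\<lambda>t' s'.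
        runs slv cst try_objective s' (\<lambda>t'' s'. runs slv cst (SetCell ''obj'' [IReg ''j''] (RNum 0)) s'
          (\<lambda>t''' s. 1 + (t + (t' + (t'' + t'''))) \<le> 2 * C + 12 * n + 15 \<and>
            fst s ''j'' = j \<and> Inv (Suc j) ((fst s)(''j'' := Suc j)) (snd s)))))"
    proof (rule runs_mono[OF attempt[where r = r1 and M = ?M1 and j = j and s = "- 1"]])
      show "holds_relaxation n m X \<omega> \<delta> ?M1"
        by (rule relax_cong[OF relax1]) simp_all
      fix t r2 M2
      assume 2: "t \<le> C + 6 * n + 6 \<and> (\<forall>v. v \<noteq> ''k'' \<longrightarrow> fst (r2, M2) v = r1 v) \<and>
        (\<forall>a. a \<noteq> ''sol'' \<and> a \<noteq> ''nrm'' \<and> a \<noteq> ''out'' \<longrightarrow> snd (r2, M2) a = ?M1 a) \<and>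
        (P_ball_optimal n m X \<omega> (vec n (\<lambda>l. ?M1 ''out'' [l])) \<or> - 1 * d $ j < 0 \<longrightarrow>
          P_ball_optimal n m X \<omega> (vec n (\<lambda>l. snd (r2, M2) ''out'' [l])))"
      have r2: "r2 ''n'' = n" "r2 ''m'' = m" "r2 ''j'' = j"
        and M2: "M2 ''A'' = M1 ''A''" "M2 ''b'' = M1 ''b''" "M2 ''c'' = M1 ''c''" "M2 ''d'' = M1 ''d''"
          "M2 ''obj'' = (M1 ''obj'')([j] := - 1)"
        using Inv 2 by (simp_all add: Inv_def)
      let ?M2 = "M2(''obj'' := (M2 ''obj'')([j] := 1))"
      have "runs slv cst try_objective (r2, ?M2)
        (\<lambda>t'' s'. runs slv cst (SetCell ''obj'' [IReg ''j''] (RNum 0)) s'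
          (\<lambda>t''' s. 1 + (t + (1 + (t'' + t'''))) \<le> 2 * C + 12 * n + 15 \<and>
            fst s ''j'' = j \<and> Inv (Suc j) ((fst s)(''j'' := Suc j)) (snd s)))"
      proof (rule runs_mono[OF attempt[where r = r2 and M = ?M2 and j = j and s = 1]])
        show "holds_relaxation n m X \<omega> \<delta> ?M2"
          by (rule relax_cong[OF relax1]) (simp_all add: M2)
        fix t' r3 M3
        assume 3: "t' \<le> C + 6 * n + 6 \<and> (\<forall>v. v \<noteq> ''k'' \<longrightarrow> fst (r3, M3) v = r2 v) \<and>
          (\<forall>a. a \<noteq> ''sol'' \<and> a \<noteq> ''nrm'' \<and> a \<noteq> ''out'' \<longrightarrow> snd (r3, M3) a = ?M2 a) \<and>
          (P_ball_optimal n m X \<omega> (vec n (\<lambda>l. ?M2 ''out'' [l])) \<or> 1 * d $ j < 0 \<longrightarrow>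
            P_ball_optimal n m X \<omega> (vec n (\<lambda>l. snd (r3, M3) ''out'' [l])))"
        have r3: "r3 ''n'' = n" "r3 ''m'' = m" "r3 ''j'' = j"
          and M3: "M3 ''A'' = M1 ''A''" "M3 ''b'' = M1 ''b''" "M3 ''c'' = M1 ''c''" "M3 ''d'' = M1 ''d''"
            "M3 ''obj'' = (M1 ''obj'')([j] := 1)"
          using r2 M2 3 by (simp_all add: Inv_def)
        let ?M3 = "M3(''obj'' := (M3 ''obj'')([j] := 0))"
        have "holds_relaxation n m X \<omega> \<delta> ?M3"
          by (rule relax_cong[OF relax1]) (simp_all add: M3)
        moreover have "P_ball_optimal n m X \<omega> (vec n (\<lambda>l. ?M3 ''out'' [l]))" if "\<exists>l<Suc j. d $ l \<noteq> 0"
        proof -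
          \<comment> \<open>An earlier success survives both attempts; for \<open>0 < d $ j\<close>
            the attempt with \<open>s = -1\<close> succeeds and the next one preserves it; for
            \<open>d $ j < 0\<close> the attempt with \<open>s = 1\<close> succeeds.\<close>
          from that consider "\<exists>l<j. d $ l \<noteq> 0" | "0 < d $ j" | "d $ j < 0"
            by (metis less_Suc_eq linorder_neqE)
          then show ?thesis
            by cases (use out1 2 3 in simp_all)
        qed
        ultimately show "runs slv cst (SetCell ''obj'' [IReg ''j''] (RNum 0)) (r3, M3)
          (\<lambda>t''' s. 1 + (t + (1 + (t' + t'''))) \<le> 2 * C + 12 * n + 15 \<and>
            fst s ''j'' = j \<and> Inv (Suc j) ((fst s)(''j'' := Suc j)) (snd s))"
          using 2 3 r3 M3 obj1 by (simp add: Inv_def)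
      next
        show "?M2 ''obj'' [l] = (if l = j then 1 else 0)" for l
          by (simp add: obj1 M2)
      qed (fact r2 j)+
      then show "runs slv cst (SetCell ''obj'' [IReg ''j''] (RNum 1)) (r2, M2) (\<lambda>t' s'.
        runs slv cst try_objective s' (\<lambda>t'' s'. runs slv cst (SetCell ''obj'' [IReg ''j''] (RNum 0)) s'
          (\<lambda>t''' s. 1 + (t + (t' + (t'' + t'''))) \<le> 2 * C + 12 * n + 15 \<and>
            fst s ''j'' = j \<and> Inv (Suc j) ((fst s)(''j'' := Suc j)) (snd s))))"
        unfolding runs_SetCell[of _ _ _ _ _ r2 M2] using r2 by simp
    next
      show "?M1 ''obj'' [l] = (if l = j then - 1 else 0)" for l
        by (simp add: obj1)
    qed (fact r1 j)+
    then show "runs slv cst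
      (Seq (SetCell ''obj'' [IReg ''j''] (RNum (- 1)))
      (Seq try_objective
      (Seq (SetCell ''obj'' [IReg ''j''] (RNum 1))
      (Seq try_objective
           (SetCell ''obj'' [IReg ''j''] (RNum 0)))))) (r1, M1)
      (\<lambda>t s. t \<le> 2 * C + 12 * n + 15 \<and> fst s ''j'' = j \<and> Inv (Suc j) ((fst s)(''j'' := Suc j)) (snd s))"
      unfolding runs_Seq runs_SetCell[of _ _ _ _ _ r1 M1]
      by (simp only: list.map ival.simps rval.simps r1 of_int_minus of_int_1)
  next
    fix t r' M' assume t: "t \<le> 2 + n * (2 * C + 12 * n + 15 + 2)" and Inv: "Inv n r' M'"
    obtain l where "l < n" "d $ l \<noteq> 0"
      using nonzero_vec_entry[OF d(1,2)] .
    then have "\<exists>l<n. d $ l \<noteq> 0"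
      by auto
    moreover have "2 * C + 12 * n + 15 + 2 = 2 * C + 12 * n + 17"
      by simp
    ultimately show "t \<le> 2 + n * (2 * C + 12 * n + 17) \<and>
        P_ball_optimal n m X \<omega> (vec n (\<lambda>l. snd (r', M') ''out'' [l]))"
      using t Inv by (simp only: Inv_def snd_conv)
  qed (use r M in \<open>simp_all add: Inv_def\<close>)
qed

text \<open>The first call yields the optimal value of the relaxation. Its negative becomes the
  constant of the last cone, so that the later programs range over the optimal pairs of the
  relaxation only.\<close>

definition dispersion_program :: com where
  "dispersion_program =
     Seq build_query
    (Seq solve_relaxation
    (Seq (SetCell ''d'' [IAdd (IReg ''m'') (INum 1)] (RSub (RNum 0) (RCell ''sol'' [IReg ''n''])))
    (Seq (SetCell ''obj'' [IReg ''n''] (RNum 0)) search_sphere)))"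

text \<open>This makes the first cone program, with \<open>\<delta> = 0\<close>, feasible: at the
  origin all bounds are nonnegative.\<close>

lemma lifted_feasible_zero:
  assumes I: "dispersion_instance n m X \<omega>"
  shows "lifted_feasible n m X \<omega> 0 (0\<^sub>v (Suc n))"
proof -
  have "0 \<le> \<omega> i * (1 + (\<Sum>j<n. (X i $ j)\<^sup>2))" if "i < m" for i
    using I that
    by (intro mult_nonneg_nonneg add_nonneg_nonneg sum_nonneg) (auto simp: dispersion_instance_def less_imp_le)
  then show ?thesis
    by (simp add: lifted_feasible_iff[OF I])
qed

text \<open>The extra constraint \<open>0 \<le> \<zeta>\<close> does no harm: pairs with negative
  \<open>\<zeta>\<close> lie below \<open>y $ n \<ge> 0\<close> anyway. The optimum itself witnesses
  feasibility of the programs with \<open>\<delta> = y $ n\<close>.\<close>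

lemma relaxation_optimum:
  assumes I: "dispersion_instance n m X \<omega>"
    and y: "is_arg_min (\<lambda>y. vec (Suc n) (\<lambda>j. if j = n then - 1 else 0) \<bullet> y) (lifted_feasible n m X \<omega> 0) y"
  shows "lifted_feasible n m X \<omega> (y $ n) y"
    and "\<forall>(x, \<zeta>) \<in> CR_ball_feasible n m X \<omega>. \<zeta> \<le> y $ n"
proof -
  have feas: "lifted_feasible n m X \<omega> 0 y"
    using y by (simp add: is_arg_min_def)
  then show "lifted_feasible n m X \<omega> (y $ n) y"
    by (simp add: lifted_feasible_def)
  have val: "vec (Suc n) (\<lambda>j. if j = n then - 1 else 0) \<bullet> z = - (z $ n)" if "z \<in> carrier_vec (Suc n)" for z :: "real vec"
    using that by (simp add: scalar_prod_conv_sum[of _ "Suc n"])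
  have "\<zeta> \<le> y $ n" if x: "(x, \<zeta>) \<in> CR_ball_feasible n m X \<omega>" for x \<zeta>
  proof (cases "0 \<le> \<zeta>")
    case True
    define z where "z = vec (Suc n) (\<lambda>l. if l < n then x $ l else \<zeta>)"
    have "vec n (\<lambda>l. z $ l) = x" "z $ n = \<zeta>"
      using x by (auto simp: z_def CR_ball_feasible_def)
    with x True have z: "lifted_feasible n m X \<omega> 0 z"
      by (simp add: lifted_feasible_def z_def)
    with y have "- (y $ n) \<le> - (z $ n)"
      using val feas unfolding is_arg_min_def lifted_feasible_def by (metis not_less)
    then show ?thesis
      using \<open>z $ n = \<zeta>\<close> by simp
  next
    case False
    then show ?thesis
      using feas by (simp add: lifted_feasible_def)
  qed
  then show "\<forall>(x, \<zeta>) \<in> CR_ball_feasible n m X \<omega>. \<zeta> \<le> y $ n"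
    by auto
qed

text \<open>The constant \<open>11\<close> is \<open>7\<close> from building the query,
  \<open>2\<close> for the assignments after the first call and \<open>2\<close> from the search
  loop.\<close>

lemma runs_dispersion_program:
  assumes slv: "poly_time_socp_solver slv cst"
    and C: "\<And>M. 1 + socp_size (socp_query M (Suc n) (m + 2) n) + cst (socp_query M (Suc n) (m + 2) n) \<le> C"
    and I: "dispersion_instance n m X \<omega>" and sol: "has_nonzero_solution n m X"
  shows "runs slv cst dispersion_program (encode_dispersion (n, m, X, \<omega>)) (\<lambda>t s.
    t \<le> 11 + m * (7 + 4 * n) + 3 * n + C + n * (2 * C + 12 * n + 17) \<and>
    outputs_P_ball_optimum (n, m, X, \<omega>) s)"
proof -
  obtain r M where enc: "encode_dispersion (n, m, X, \<omega>) = (r, M)"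
    by fastforce
  show ?thesis
    unfolding dispersion_program_def enc runs_Seq
  proof (rule runs_mono[OF runs_build_query[OF enc]])
    fix t r1 M1
    assume 1: "t \<le> 7 + m * (7 + 4 * n) + 3 * n \<and>
      fst (r1, M1) ''n'' = n \<and> fst (r1, M1) ''m'' = m \<and> holds_relaxation n m X \<omega> 0 (snd (r1, M1)) \<and>
      (\<forall>j. snd (r1, M1) ''obj'' [j] = (if j = n then - 1 else 0))"
    define Q where "Q = socp_query M1 (Suc n) (m + 2) n"
    have CQ: "1 + socp_size Q + cst Q \<le> C"
      unfolding Q_def by (rule C)
    define y where "y = slv Q"
    have "is_arg_min (\<lambda>y. vec (Suc n) (\<lambda>j. M1 ''obj'' [j]) \<bullet> y) (lifted_feasible n m X \<omega> 0) y"
      unfolding y_def Q_def using 1 by (intro solver_minimises[OF slv I _ lifted_feasible_zero[OF I]]) simp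
    moreover have "(\<lambda>j. M1 ''obj'' [j]) = (\<lambda>j. if j = n then - 1 else 0)"
      using 1 by auto
    ultimately have "is_arg_min (\<lambda>y. vec (Suc n) (\<lambda>j. if j = n then - 1 else 0) \<bullet> y) (lifted_feasible n m X \<omega> 0) y"
      by simp
    note opt = relaxation_optimum[OF I this]
    define M2 where "M2 = store_solution (Suc n) y M1"
    have M2: "M2 ''sol'' [n] = y $ n" "\<And>a. a \<noteq> ''sol'' \<Longrightarrow> M2 a = M1 a"
      by (auto simp: M2_def store_solution_def)
    define M3 where "M3 = M2(''d'' := (M2 ''d'')([Suc m] := - (y $ n)), ''obj'' := (M2 ''obj'')([n] := 0))"
    have "runs slv cst search_sphere (r1, M3) (\<lambda>t S. t \<le> 2 + n * (2 * C + 12 * n + 17) \<and>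
        P_ball_optimal n m X \<omega> (vec n (\<lambda>l. snd S ''out'' [l])))"
      using 1 M2 by (intro runs_search_sphere[OF slv C I sol opt(2,1)]) (auto simp: M3_def holds_relaxation_def)
    then have "runs slv cst search_sphere (r1, M3)
      (\<lambda>t' s. t + (1 + socp_size Q + cst Q + (1 + (1 + t')))
          \<le> 11 + m * (7 + 4 * n) + 3 * n + C + n * (2 * C + 12 * n + 17) \<and>
        outputs_P_ball_optimum (n, m, X, \<omega>) s)"
      by (rule runs_mono) (use 1 CQ in simp)
    moreover have "socp_query M1 (Suc n) (Suc (Suc m)) n = Q"
      by (simp add: Q_def)
    ultimately show "runs slv cst solve_relaxation (r1, M1) (\<lambda>t' s'.
      runs slv cst (SetCell ''d'' [IAdd (IReg ''m'') (INum 1)] (RSub (RNum 0) (RCell ''sol'' [IReg ''n'']))) s'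
      (\<lambda>t'' s'. runs slv cst (SetCell ''obj'' [IReg ''n''] (RNum 0)) s' (\<lambda>t''' s'.
        runs slv cst search_sphere s' (\<lambda>t4 s.
          t + (t' + (t'' + (t''' + t4))) \<le> 11 + m * (7 + 4 * n) + 3 * n + C + n * (2 * C + 12 * n + 17) \<and>
          outputs_P_ball_optimum (n, m, X, \<omega>) s))))"
      using 1 M2 unfolding solve_relaxation_def
      by (simp add: Let_def M3_def y_def[symmetric] M2_def[symmetric] del: outputs_P_ball_optimum.simps)
  qed
qed

section \<open>Polynomial bound on the running time\<close>

lemma poly_nat_mono: "a \<le> b \<Longrightarrow> poly q a \<le> poly q b" for q :: "nat poly"
  by (induction q) (auto intro: add_mono mult_mono)

text \<open>The size is independent of the memory contents, which lets a single \<open>C\<close>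
  bound every call.\<close>

lemma socp_size_query: "socp_size (socp_query M N K R) = N + K * (R * N + R + N + 1)"
  by (simp add: socp_query_def o_def sum_list_triv)

lemma P_ball_poly_time:
  "P_ball_poly_time_on {(n, m, X, \<omega>). dispersion_instance n m X \<omega> \<and> has_nonzero_solution n m X}"
  unfolding P_ball_poly_time_on_def poly_time_solvable_def
proof (intro exI[of _ dispersion_program] allI impI)
  fix slv cst assume slv: "poly_time_socp_solver slv cst"
  then obtain q :: "nat poly" where q: "\<And>I. cst I \<le> poly q (socp_size I)"
    unfolding poly_time_socp_solver_def by blast
  define x :: "nat poly" where "x = [:0, 1:]"
  \<comment> \<open>With \<open>x\<close> standing for the input size, \<open>z\<close> bounds the
    size of a query, \<open>c\<close> the cost of a call including the solver's time, and
    \<open>p\<close> the total time.\<close>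
  define z where "z = (x + 1) + (x + 2) * (x * (x + 1) + x + (x + 1) + 1)"
  define c where "c = 1 + z + pcompose q z"
  define p where "p = 11 + x * (7 + 4 * x) + 3 * x + c + x * (2 * c + 12 * x + 17)"
  have x: "poly x a = a" for a
    by (simp add: x_def)
  show "\<exists>p :: nat poly. \<forall>I \<in> {(n, m, X, \<omega>). dispersion_instance n m X \<omega> \<and> has_nonzero_solution n m X}.
      \<exists>t s. exec slv cst dispersion_program (encode_dispersion I) t s \<and>
        t \<le> poly p (dispersion_size I) \<and> outputs_P_ball_optimum I s"
  proof (intro exI[of _ p] ballI)
    fix I assume "I \<in> {(n, m, X, \<omega>). dispersion_instance n m X \<omega> \<and> has_nonzero_solution n m X}"
    then obtain n m X \<omega> where I: "I = (n, m, X, \<omega>)" "dispersion_instance n m X \<omega>" "has_nonzero_solution n m X"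
      by auto
    define S where "S = m * n + m"
    have "1 \<le> m"
      using I(2) by (simp add: dispersion_instance_def)
    \<comment> \<open>\<open>1 \<le> m\<close> gives \<open>n \<le> m * n\<close>.\<close>
    then have le: "n \<le> S" "m \<le> S"
      by (auto simp: S_def trans_le_add1)
    have size: "socp_size (socp_query M (Suc n) (m + 2) n) \<le> poly z S" for M
    proof -
      have "poly z S = (S + 1) + (S + 2) * (S * (S + 1) + S + (S + 1) + 1)"
        by (simp add: z_def x)
      moreover have "(n + 1) + (m + 2) * (n * (n + 1) + n + (n + 1) + 1) \<le>
          (S + 1) + (S + 2) * (S * (S + 1) + S + (S + 1) + 1)"
        using le by (intro add_mono mult_mono order_refl) auto
      ultimately show ?thesis
        by (simp add: socp_size_query)
    qed
    have "1 + socp_size (socp_query M (Suc n) (m + 2) n) + cst (socp_query M (Suc n) (m + 2) n) \<le> poly c S" for M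
    proof -
      have "cst (socp_query M (Suc n) (m + 2) n) \<le> poly q (poly z S)"
        using q poly_nat_mono[OF size] by (rule order_trans)
      with size[of M] show ?thesis
        by (simp add: c_def poly_pcompose)
    qed
    from runs_dispersion_program[OF slv this I(2,3)] obtain t s where
      *: "exec slv cst dispersion_program (encode_dispersion I) t s" "outputs_P_ball_optimum I s"
      and t: "t \<le> 11 + m * (7 + 4 * n) + 3 * n + poly c S + n * (2 * poly c S + 12 * n + 17)"
      unfolding runs_def I(1) by (elim exE conjE)
    note t
    also have "11 + m * (7 + 4 * n) + 3 * n + poly c S + n * (2 * poly c S + 12 * n + 17) \<le>
        11 + S * (7 + 4 * S) + 3 * S + poly c S + S * (2 * poly c S + 12 * S + 17)"
      using le by (intro add_mono mult_mono order_refl) auto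
    also have "\<dots> = poly p (dispersion_size I)"
      by (simp add: p_def x I(1) S_def[symmetric])
    finally show "\<exists>t s. exec slv cst dispersion_program (encode_dispersion I) t s \<and>
        t \<le> poly p (dispersion_size I) \<and> outputs_P_ball_optimum I s"
      using * by (intro exI conjI)
  qed
qed

theorem theorem3p1:
  shows "(\<forall>n m X \<omega>. dispersion_instance n m X \<omega> \<and> has_nonzero_solution n m X
            \<longrightarrow> v_P_ball n m X \<omega> = v_CR_ball n m X \<omega>)
       \<and> P_ball_poly_time_on
            {(n, m, X, \<omega>). dispersion_instance n m X \<omega> \<and> has_nonzero_solution n m X}
       \<and> (\<forall>n m X \<omega>. dispersion_instance n m X \<omega> \<and> m \<le> n \<longrightarrow> has_nonzero_solution n m X)"
  by (intro conjI allI impI P_ball_poly_time) (elim conjE, rule v_P_ball_eq_v_CR_ball has_nonzero_solution_if_le; assumption)+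

end
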